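(* Let $k\ge 3$ be an integer. There exist constants $c=c(k)>0$ and $n_0=n_0(k)$ such that for every $n\ge n_0$: if $G$ is a graph on $n$ vertices with $q(G)\ge q(T_{n,k})$ and $G$ is not isomorphic to $T_{n,k}$, then $G$ contains a copy of the generalized book $B_{k,t}$ for some $t\ge c\,n$.
   Context: All graphs are finite and simple. $q(G)$ denotes the largest eigenvalue of the signless Laplacian $Q(G)=D(G)+A(G)$. $T_{n,k}$ is the complete $k$-partite graph on $n$ vertices with part sizes differing by at most one. The generalized book $B_{k,t}=K_k\vee I_t$ is the graph consisting of a clique $K_k$ and an independent set $I_t$ of size $t$, with every vertex of the clique joined to every vertex of the independent set (equivalently, $t$ copies of $K_{k+1}$ sharing a common $K_k$). *)

theory Defs
  imports Complex_Main "Jordan_Normal_Form.Char_Poly"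
begin

text \<open>A finite simple graph on the vertex set {0..<n} is given by an edge relation
  E that is symmetric and irreflexive on {0..<n} (its values outside are irrelevant).\<close>

definition simple_graph :: "nat \<Rightarrow> (nat \<Rightarrow> nat \<Rightarrow> bool) \<Rightarrow> bool" where
  "simple_graph n E \<longleftrightarrow> (\<forall>i<n. \<forall>j<n. E i j \<longrightarrow> E j i) \<and> (\<forall>i<n. \<not> E i i)"

definition degree :: "nat \<Rightarrow> (nat \<Rightarrow> nat \<Rightarrow> bool) \<Rightarrow> nat \<Rightarrow> nat" where
  "degree n E i = card {j. j < n \<and> E i j}"

definition signless_laplacian :: "nat \<Rightarrow> (nat \<Rightarrow> nat \<Rightarrow> bool) \<Rightarrow> real mat" where
  "signless_laplacian n E =
     mat n n (\<lambda>(i, j). (if i = j then real (degree n E i) else 0) + (if E i j then 1 else 0))"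

text \<open>q(G): the largest eigenvalue of Q(G) (Q(G) is real symmetric, so all eigenvalues are real).\<close>

definition q_index :: "nat \<Rightarrow> (nat \<Rightarrow> nat \<Rightarrow> bool) \<Rightarrow> real" where
  "q_index n E = Max {k. eigenvalue (signless_laplacian n E) k}"

text \<open>Turan graph T_{n,k}: complete k-partite graph on {0..<n}, vertex i in part (i mod k);
  part sizes differ by at most one.\<close>

definition turan :: "nat \<Rightarrow> nat \<Rightarrow> nat \<Rightarrow> bool" where
  "turan k i j \<longleftrightarrow> i mod k \<noteq> j mod k"

definition graph_iso :: "nat \<Rightarrow> (nat \<Rightarrow> nat \<Rightarrow> bool) \<Rightarrow> (nat \<Rightarrow> nat \<Rightarrow> bool) \<Rightarrow> bool" where
  "graph_iso n E F \<longleftrightarrow>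
     (\<exists>f. bij_betw f {..<n} {..<n} \<and> (\<forall>i<n. \<forall>j<n. E i j \<longleftrightarrow> F (f i) (f j)))"

text \<open>G contains a copy (subgraph) of the generalized book B_{k,t} = K_k join I_t.\<close>

definition contains_book :: "nat \<Rightarrow> (nat \<Rightarrow> nat \<Rightarrow> bool) \<Rightarrow> nat \<Rightarrow> nat \<Rightarrow> bool" where
  "contains_book n E k t \<longleftrightarrow>
     (\<exists>S T. S \<subseteq> {..<n} \<and> T \<subseteq> {..<n} \<and> S \<inter> T = {} \<and> card S = k \<and> card T = t \<and>
        (\<forall>u\<in>S. \<forall>v\<in>S. u \<noteq> v \<longrightarrow> E u v) \<and> (\<forall>u\<in>S. \<forall>v\<in>T. E u v))"

end

theory Submission
  imports Defs "HOL-Analysis.Function_Topology" "HOL-Analysis.Convex"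
begin

text \<open>Write \<open>q(W)\<close> for the signless Laplacian index of the subgraph induced by \<open>W\<close>, and \<open>m = |W|\<close>.
  If some degree in \<open>W\<close> is below \<open>(1 - 1/k - \<eta>) m\<close> while \<open>q(W)\<close> is close to \<open>(2 - 2/k) m\<close> or larger, the smallest
  Perron entry is noticeably below \<open>m\<close> to the power \<open>-1/2\<close>, and deleting that vertex increases \<open>q(W) / m\<close> by a constant
  times \<open>1/m\<close> (here \<open>k \<ge> 3\<close> enters, through \<open>q > m\<close>). As \<open>q(W) \<le> 2 m\<close>, the deletions stop while linearly many
  vertices are left. The remaining graph has minimum degree at least \<open>(1 - 1/k - \<eta>) m\<close> and no large book,
  so all vertices attach to the near-partition given by a single \<open>k\<close>-clique and the graph is \<open>k\<close>-partite;
  hence \<open>q(W) \<le> (2 - 2/k) m\<close>. This contradicts the growth unless nothing was deleted. In that case the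
  graph itself is \<open>k\<close>-partite with parts of sizes \<open>n\<^sub>i\<close>, its Perron vector gives
  \<open>\<Sum> n\<^sub>i / (q - n + 2 n\<^sub>i) \<ge> 1\<close>, and strict concavity leaves only the Turan graph.\<close>

section \<open>The signless Laplacian form\<close>

definition graph_on :: "'a set \<Rightarrow> ('a \<Rightarrow> 'a \<Rightarrow> bool) \<Rightarrow> bool" where
  "graph_on W E \<longleftrightarrow> finite W \<and> (\<forall>u\<in>W. \<forall>v\<in>W. E u v \<longrightarrow> E v u) \<and> (\<forall>u\<in>W. \<not> E u u)"

definition nbrs :: "'a set \<Rightarrow> ('a \<Rightarrow> 'a \<Rightarrow> bool) \<Rightarrow> 'a \<Rightarrow> 'a set" where
  "nbrs W E u = {v \<in> W. E u v}"

text \<open>The entry at \<open>u\<close> of \<open>Q x\<close>, for the signless Laplacian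
  \<open>Q = D + A\<close> of the subgraph induced by \<open>W\<close>.\<close>

definition sl_op :: "'a set \<Rightarrow> ('a \<Rightarrow> 'a \<Rightarrow> bool) \<Rightarrow> ('a \<Rightarrow> real) \<Rightarrow> 'a \<Rightarrow> real" where
  "sl_op W E x u = (\<Sum>v\<in>nbrs W E u. x u + x v)"

text \<open>The quadratic form \<open>x^T Q x\<close>; halving compensates for counting every edge
  in both orders.\<close>

definition sl_form :: "'a set \<Rightarrow> ('a \<Rightarrow> 'a \<Rightarrow> bool) \<Rightarrow> ('a \<Rightarrow> real) \<Rightarrow> real" where
  "sl_form W E x = (\<Sum>u\<in>W. \<Sum>v\<in>nbrs W E u. (x u + x v)\<^sup>2) / 2"

text \<open>The largest eigenvalue as a Rayleigh supremum. It is available on every vertex set, so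
  vertices can be deleted without relabelling, and any test vector yields a lower bound.\<close>

definition q_max :: "'a set \<Rightarrow> ('a \<Rightarrow> 'a \<Rightarrow> bool) \<Rightarrow> real" where
  "q_max W E = (SUP x\<in>{x. (\<Sum>u\<in>W. (x u)\<^sup>2) = 1}. sl_form W E x)"

lemma graph_on_subset: "graph_on W E \<Longrightarrow> V \<subseteq> W \<Longrightarrow> graph_on V E"
  by (auto simp: graph_on_def intro: finite_subset)

lemma finite_nbrs [simp]: "finite W \<Longrightarrow> finite (nbrs W E u)"
  by (simp add: nbrs_def)

lemma nbrs_subset: "nbrs W E u \<subseteq> W"
  by (auto simp: nbrs_def)

lemma sum_nbrs_swap:
  assumes "graph_on W E"
  shows "(\<Sum>u\<in>W. \<Sum>v\<in>nbrs W E u. f u v) = (\<Sum>u\<in>W. \<Sum>v\<in>nbrs W E u. f v u)"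
proof -
  have "(\<Sum>u\<in>W. \<Sum>v\<in>nbrs W E u. f u v) = (\<Sum>v\<in>W. \<Sum>u\<in>{u\<in>W. E u v}. f u v)"
    unfolding nbrs_def using assms by (intro sum.swap_restrict) (auto simp: graph_on_def)
  also have "\<dots> = (\<Sum>u\<in>W. \<Sum>v\<in>nbrs W E u. f v u)"
    using assms by (intro sum.cong) (auto simp: graph_on_def nbrs_def)
  finally show ?thesis .
qed

text \<open>The factor \<open>x u + x v\<close> is symmetric in the ordered pair, so the terms with
  \<open>y v\<close> contribute as much as those with \<open>y u\<close>.\<close>

lemma sl_bilinear:
  assumes "graph_on W E"
  shows "(\<Sum>u\<in>W. \<Sum>v\<in>nbrs W E u. (x u + x v) * (y u + y v)) = 2 * (\<Sum>u\<in>W. y u * sl_op W E x u)"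
proof -
  have "(\<Sum>u\<in>W. \<Sum>v\<in>nbrs W E u. (x u + x v) * (y u + y v)) =
      (\<Sum>u\<in>W. \<Sum>v\<in>nbrs W E u. (x u + x v) * y u) + (\<Sum>u\<in>W. \<Sum>v\<in>nbrs W E u. (x u + x v) * y v)"
    by (simp add: ring_distribs sum.distrib)
  also have "(\<Sum>u\<in>W. \<Sum>v\<in>nbrs W E u. (x u + x v) * y v) = (\<Sum>u\<in>W. \<Sum>v\<in>nbrs W E u. (x u + x v) * y u)"
    by (subst sum_nbrs_swap[OF assms]) (simp add: add.commute)
  finally show ?thesis
    by (simp add: sl_op_def sum_distrib_left sum_distrib_right mult.commute)
qed

lemma sl_form_eq:
  assumes "graph_on W E"
  shows "sl_form W E x = (\<Sum>u\<in>W. x u * sl_op W E x u)"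
  using sl_bilinear[OF assms, of x x] by (simp add: sl_form_def power2_eq_square)

lemma sl_form_add:
  assumes "graph_on W E"
  shows "sl_form W E (\<lambda>u. x u + t * y u) =
    sl_form W E x + 2 * t * (\<Sum>u\<in>W. y u * sl_op W E x u) + t\<^sup>2 * sl_form W E y"
proof -
  have "(\<Sum>u\<in>W. \<Sum>v\<in>nbrs W E u. ((x u + t * y u) + (x v + t * y v))\<^sup>2) =
     (\<Sum>u\<in>W. \<Sum>v\<in>nbrs W E u. (x u + x v)\<^sup>2 + (2 * t) * ((x u + x v) * (y u + y v)) + t\<^sup>2 * (y u + y v)\<^sup>2)"
    by (intro sum.cong refl) (simp add: power2_eq_square algebra_simps)
  also have "\<dots> = (\<Sum>u\<in>W. \<Sum>v\<in>nbrs W E u. (x u + x v)\<^sup>2) 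
      + (2 * t) * (\<Sum>u\<in>W. \<Sum>v\<in>nbrs W E u. (x u + x v) * (y u + y v)) 
      + t\<^sup>2 * (\<Sum>u\<in>W. \<Sum>v\<in>nbrs W E u. (y u + y v)\<^sup>2)"
    by (simp add: sum.distrib sum_distrib_left)
  finally show ?thesis
    unfolding sl_form_def sl_bilinear[OF assms] by (simp add: field_simps)
qed

text \<open>Each edge term is at most \<open>2 * (x u)\<^sup>2 + 2 * (x v)\<^sup>2\<close>, summed
  here over all pairs. This crude bound makes the supremum in \<open>q_max\<close> finite and caps
  \<open>q_max W E / card W\<close> at 2.\<close>

lemma sl_form_le:
  assumes "graph_on W E"
  shows "sl_form W E x \<le> 2 * real (card W) * (\<Sum>u\<in>W. (x u)\<^sup>2)"
proof -
  have fin: "finite W" using assms by (simp add: graph_on_def)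
  have "(\<Sum>u\<in>W. \<Sum>v\<in>nbrs W E u. (x u + x v)\<^sup>2) \<le> (\<Sum>u\<in>W. \<Sum>v\<in>nbrs W E u. 2 * (x u)\<^sup>2 + 2 * (x v)\<^sup>2)"
  proof (intro sum_mono)
    fix u v
    have "0 \<le> (x u - x v)\<^sup>2" by simp
    then show "(x u + x v)\<^sup>2 \<le> 2 * (x u)\<^sup>2 + 2 * (x v)\<^sup>2"
      by (simp add: power2_eq_square algebra_simps)
  qed
  also have "\<dots> \<le> (\<Sum>u\<in>W. \<Sum>v\<in>W. 2 * (x u)\<^sup>2 + 2 * (x v)\<^sup>2)"
    using fin nbrs_subset by (intro sum_mono sum_mono2) fastforce+
  also have "\<dots> = 4 * real (card W) * (\<Sum>u\<in>W. (x u)\<^sup>2)"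
    by (simp add: sum.distrib sum_distrib_left[symmetric])
  finally show ?thesis by (simp add: sl_form_def)
qed

lemma sl_form_scale: "sl_form W E (\<lambda>u. c * x u) = c\<^sup>2 * sl_form W E x"
proof -
  have "(\<Sum>u\<in>W. \<Sum>v\<in>nbrs W E u. (c * x u + c * x v)\<^sup>2) = (\<Sum>u\<in>W. \<Sum>v\<in>nbrs W E u. c\<^sup>2 * (x u + x v)\<^sup>2)"
    by (intro sum.cong refl) (simp add: power2_eq_square algebra_simps)
  then show ?thesis by (simp add: sl_form_def sum_distrib_left)
qed

lemma bdd_above_sl_form:
  assumes "graph_on W E"
  shows "bdd_above (sl_form W E ` {x. (\<Sum>u\<in>W. (x u)\<^sup>2) = 1})"
proof (rule bdd_aboveI2)
  fix x :: "'a \<Rightarrow> real" assume "x \<in> {x. (\<Sum>u\<in>W. (x u)\<^sup>2) = 1}"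
  then show "sl_form W E x \<le> 2 * real (card W)" using sl_form_le[OF assms, of x] by simp
qed

lemma sl_form_le_q_max:
  assumes "graph_on W E"
  shows "sl_form W E x \<le> q_max W E * (\<Sum>u\<in>W. (x u)\<^sup>2)"
proof (cases "(\<Sum>u\<in>W. (x u)\<^sup>2) = 0")
  case True
  then show ?thesis using sl_form_le[OF assms, of x] by simp
next
  case False
  define s where "s = (\<Sum>u\<in>W. (x u)\<^sup>2)"
  have s: "s > 0" using False sum_nonneg[of W "\<lambda>u. (x u)\<^sup>2"] by (simp add: s_def)
  define y where "y = (\<lambda>u. (1 / sqrt s) * x u)"
  have "(\<Sum>u\<in>W. (y u)\<^sup>2) = (1 / s) * s"
    using s unfolding y_def s_def[symmetric] by (simp add: power_mult_distrib power_divide sum_divide_distrib[symmetric] s_def)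
  then have "(\<Sum>u\<in>W. (y u)\<^sup>2) = 1" using s by simp
  then have "sl_form W E y \<le> q_max W E"
    unfolding q_max_def by (intro cSUP_upper bdd_above_sl_form assms) simp
  moreover have "sl_form W E y = (1 / s) * sl_form W E x"
    using s unfolding y_def sl_form_scale by (simp add: power_divide)
  ultimately show ?thesis using s by (simp add: s_def[symmetric] field_simps)
qed

lemma sum_indicator_sq:
  assumes "finite W" "w \<in> W"
  shows "(\<Sum>u\<in>W. (if u = w then 1 else 0 :: real)\<^sup>2) = 1"
proof -
  have "(\<Sum>u\<in>W. (if u = w then 1 else 0 :: real)\<^sup>2) = (\<Sum>u\<in>W. if u = w then 1 else 0)"
    by (intro sum.cong) auto
  then show ?thesis using assms by simp
qed

lemma q_max_le:
  assumes "graph_on W E" "W \<noteq> {}"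
  shows "q_max W E \<le> 2 * real (card W)"
  unfolding q_max_def
proof (rule cSUP_least)
  obtain w where w: "w \<in> W" using assms by auto
  show "{x. (\<Sum>u\<in>W. (x u)\<^sup>2) = (1::real)} \<noteq> {}"
    using sum_indicator_sq[of W w] assms w by (auto simp: graph_on_def)
next
  fix x :: "'a \<Rightarrow> real" assume "x \<in> {x. (\<Sum>u\<in>W. (x u)\<^sup>2) = 1}"
  then show "sl_form W E x \<le> 2 * real (card W)" using sl_form_le[OF assms(1), of x] by simp
qed

section \<open>Maximisers of the form and Perron vectors\<close>

lemma q_max_attained:
  assumes "graph_on W E" "W \<noteq> {}"
  shows "\<exists>x. (\<Sum>u\<in>W. (x u)\<^sup>2) = 1 \<and> sl_form W E x = q_max W E"
proof -
  have fin: "finite W" using assms by (simp add: graph_on_def)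
  obtain w where w: "w \<in> W" using assms by auto
  \<comment> \<open>Pinning the values off \<open>W\<close> to 0 makes \<open>B\<close> a product of
    compact sets, hence compact by Tychonoff.\<close>
  define B where "B = (PiE UNIV (\<lambda>u. if u \<in> W then {-1..1} else {0}) :: ('a \<Rightarrow> real) set)"
  define K where "K = B \<inter> {x. (\<Sum>u\<in>W. (x u)\<^sup>2) = 1}"
  have "compactin (product_topology (\<lambda>_. euclidean) UNIV) B"
    unfolding B_def compactin_PiE by auto
  then have "compact B" by (simp add: euclidean_product_topology)
  moreover have "closed {x :: 'a \<Rightarrow> real. (\<Sum>u\<in>W. (x u)\<^sup>2) = 1}"
    by (intro closed_Collect_eq continuous_intros continuous_on_product_coordinates)
  ultimately have "compact K" unfolding K_def by (rule compact_Int_closed)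
  moreover have "K \<noteq> {}"
  proof -
    have "(\<lambda>u. if u = w then 1 else 0) \<in> K"
      using sum_indicator_sq[OF fin w] w by (auto simp: K_def B_def)
    then show ?thesis by blast
  qed
  moreover have "continuous_on K (sl_form W E)"
    unfolding sl_form_def by (intro continuous_intros continuous_on_subset[OF continuous_on_product_coordinates]) auto
  ultimately obtain x where x: "x \<in> K" and max: "\<And>y. y \<in> K \<Longrightarrow> sl_form W E y \<le> sl_form W E x"
    using continuous_attains_sup[of K "sl_form W E"] by blast
  have "sl_form W E y \<le> sl_form W E x" if y: "(\<Sum>u\<in>W. (y u)\<^sup>2) = 1" for y
  proof -
    \<comment> \<open>Cutting \<open>y\<close> off outside \<open>W\<close> changes neither norm nor
      form, so the maximum over \<open>K\<close> is the maximum over all unit vectors.\<close>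
    define z where "z = (\<lambda>u. if u \<in> W then y u else 0)"
    have "\<bar>y u\<bar> \<le> 1" if "u \<in> W" for u
    proof -
      have "(y u)\<^sup>2 \<le> (\<Sum>u\<in>W. (y u)\<^sup>2)" using that fin by (intro member_le_sum) auto
      then show ?thesis using y by (simp add: abs_square_le_1)
    qed
    then have "- 1 \<le> y u \<and> y u \<le> 1" if "u \<in> W" for u using that by (auto simp: abs_le_iff)
    then have "z \<in> K" using y by (auto simp: K_def B_def z_def)
    moreover have "sl_form W E z = sl_form W E y"
      unfolding sl_form_def z_def using nbrs_subset[of W E]
      by (intro arg_cong[of _ _ "\<lambda>s. s / 2"] sum.cong refl) (auto simp: subset_iff)
    ultimately show ?thesis using max by metis
  qed
  then have "q_max W E = sl_form W E x"
    unfolding q_max_def using x by (intro cSup_eq_maximum) (auto simp: K_def)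
  then show ?thesis using x by (auto simp: K_def)
qed

text \<open>At \<open>t = a / d\<close> with \<open>d > \<bar>b\<bar>\<close> the quadratic term
  cannot absorb the linear one: the expression is at least \<open>a\<^sup>2 / d\<close>.\<close>

lemma linear_coefficient_zero:
  fixes a b :: real
  assumes "\<And>t. 2 * t * a + t\<^sup>2 * b \<le> 0"
  shows "a = 0"
proof (rule ccontr)
  assume "a \<noteq> 0"
  define d where "d = \<bar>b\<bar> + 1"
  have d: "d > 0" "b \<ge> - d" by (auto simp: d_def)
  have "2 * (a / d) * a - (a / d)\<^sup>2 * d \<le> 2 * (a / d) * a + (a / d)\<^sup>2 * b"
    using mult_left_mono[OF d(2), of "(a / d)\<^sup>2"] by simp
  moreover have "2 * (a / d) * a - (a / d)\<^sup>2 * d = a\<^sup>2 / d"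
    using d by (simp add: power2_eq_square field_simps)
  moreover have "a\<^sup>2 / d > 0" using d \<open>a \<noteq> 0\<close> by simp
  ultimately show False using assms[of "a / d"] by linarith
qed

text \<open>Entrywise absolute values keep the norm and decrease no edge term, so some maximiser is
  nonnegative. Perturbing it along one coordinate and comparing first-order terms gives the
  eigenvalue equation there.\<close>

lemma perron_vector:
  assumes "graph_on W E" "W \<noteq> {}"
  obtains x where "\<And>u. x u \<ge> 0" "(\<Sum>u\<in>W. (x u)\<^sup>2) = 1" "sl_form W E x = q_max W E"
    "\<And>u. u \<in> W \<Longrightarrow> sl_op W E x u = q_max W E * x u"
proof -
  have fin: "finite W" using assms by (simp add: graph_on_def)
  obtain z where z: "(\<Sum>u\<in>W. (z u)\<^sup>2) = 1" "sl_form W E z = q_max W E"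
    using q_max_attained[OF assms] by blast
  define x where "x = (\<lambda>u. \<bar>z u\<bar>)"
  have norm: "(\<Sum>u\<in>W. (x u)\<^sup>2) = 1" using z by (simp add: x_def)
  have "sl_form W E z \<le> sl_form W E x"
  proof -
    have "(z u + z v)\<^sup>2 \<le> (x u + x v)\<^sup>2" for u v
      unfolding x_def by (rule abs_le_square_iff[THEN iffD1]) linarith
    then show ?thesis unfolding sl_form_def by (intro divide_right_mono sum_mono) auto
  qed
  moreover have "sl_form W E x \<le> q_max W E" using sl_form_le_q_max[OF assms(1), of x] norm by simp
  ultimately have form: "sl_form W E x = q_max W E" using z by simp
  have "sl_op W E x w = q_max W E * x w" if w: "w \<in> W" for w
  proof -
    define e where "e = (\<lambda>u. if u = w then 1 else 0 :: real)"
    have e1: "(\<Sum>u\<in>W. e u * f u) = f w" for f :: "'a \<Rightarrow> real"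
      using w fin by (simp add: e_def if_distrib[of "\<lambda>c. c * _"] cong: if_cong)
    have e2: "(\<Sum>u\<in>W. (e u)\<^sup>2) = 1" using e1[of e] by (simp add: power2_eq_square) (simp add: e_def)
    \<comment> \<open>This is \<open>sl_form_le_q_max\<close> at \<open>x + t * e\<close> after the
      constant terms cancel.\<close>
    have "2 * t * (sl_op W E x w - q_max W E * x w) + t\<^sup>2 * (sl_form W E e - q_max W E) \<le> 0" for t
    proof -
      have "(\<Sum>u\<in>W. (x u + t * e u)\<^sup>2) = (\<Sum>u\<in>W. (x u)\<^sup>2 + 2 * t * (e u * x u) + t\<^sup>2 * (e u)\<^sup>2)"
        by (intro sum.cong refl) (simp add: power2_eq_square algebra_simps)
      also have "\<dots> = 1 + 2 * t * x w + t\<^sup>2"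
        by (simp only: sum.distrib sum_distrib_left[symmetric] norm e1 e2)
      finally show ?thesis
        using sl_form_le_q_max[OF assms(1), of "\<lambda>u. x u + t * e u"]
        unfolding sl_form_add[OF assms(1)] e1 form by (simp add: algebra_simps)
    qed
    from linear_coefficient_zero[OF this] show ?thesis by simp
  qed
  then show ?thesis using that[of x] norm form by (simp add: x_def)
qed

section \<open>Agreement of the Rayleigh supremum with the matrix index\<close>

lemma sl_op_eq:
  "sl_op W E x u = real (card (nbrs W E u)) * x u + (\<Sum>v\<in>nbrs W E u. x v)"
  by (simp add: sl_op_def sum.distrib)

text \<open>The matrix acts as \<open>sl_op\<close>. The Perron vector makes \<open>q_max\<close> an
  eigenvalue, and evaluating the form at any eigenvector bounds its eigenvalue by
  \<open>q_max\<close>.\<close>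

lemma q_index_eq_q_max:
  assumes G: "simple_graph n E" and n: "n > 0"
  shows "q_index n E = q_max {..<n} E"
proof -
  have gr: "graph_on {..<n} E" using G by (auto simp: graph_on_def simple_graph_def)
  define A where "A = signless_laplacian n E"
  have A: "A \<in> carrier_mat n n" by (simp add: A_def signless_laplacian_def)
  have mv: "(A *\<^sub>v v) $ i = sl_op {..<n} E (\<lambda>j. v $ j) i" if v: "v \<in> carrier_vec n" and i: "i < n" for v i
  proof -
    have "(A *\<^sub>v v) $ i = (\<Sum>j<n. ((if i = j then real (Defs.degree n E i) else 0) + (if E i j then 1 else 0)) * v $ j)"
      using v i by (simp add: A_def signless_laplacian_def scalar_prod_def lessThan_atLeast0)
    also have "\<dots> = (\<Sum>j<n. if i = j then real (Defs.degree n E i) * v $ j else 0) + (\<Sum>j<n. if E i j then v $ j else 0)"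
      unfolding sum.distrib[symmetric] by (intro sum.cong) (auto simp: ring_distribs)
    also have "(\<Sum>j<n. if E i j then v $ j else 0) = (\<Sum>j\<in>nbrs {..<n} E i. v $ j)"
      by (simp add: nbrs_def sum.inter_filter[of "{..<n}", simplified])
    finally show ?thesis using i
      by (simp add: sl_op_eq nbrs_def Defs.degree_def)
  qed
  have eig: "eigenvalue A k \<longleftrightarrow> (\<exists>x. (\<exists>i<n. x i \<noteq> 0) \<and> (\<forall>i<n. sl_op {..<n} E x i = k * x i))" for k
  proof
    assume "eigenvalue A k"
    then obtain v where v: "v \<in> carrier_vec n" "v \<noteq> 0\<^sub>v n" "A *\<^sub>v v = k \<cdot>\<^sub>v v"
      using A by (auto simp: eigenvalue_def eigenvector_def)
    have "\<exists>i<n. v $ i \<noteq> 0"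
    proof (rule ccontr)
      assume "\<not> (\<exists>i<n. v $ i \<noteq> 0)"
      then have "v = 0\<^sub>v n" using v(1) by (intro eq_vecI) auto
      with v show False by simp
    qed
    moreover have "\<forall>i<n. sl_op {..<n} E (\<lambda>j. v $ j) i = k * v $ i"
      using mv[OF v(1)] v by auto
    ultimately show "\<exists>x. (\<exists>i<n. x i \<noteq> 0) \<and> (\<forall>i<n. sl_op {..<n} E x i = k * x i)" by blast
  next
    assume "\<exists>x. (\<exists>i<n. x i \<noteq> 0) \<and> (\<forall>i<n. sl_op {..<n} E x i = k * x i)"
    then obtain x where x: "\<exists>i<n. x i \<noteq> 0" "\<forall>i<n. sl_op {..<n} E x i = k * x i" by blast
    define v where "v = vec n x"
    have v: "v \<in> carrier_vec n" by (simp add: v_def)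
    have "sl_op {..<n} E (\<lambda>j. v $ j) i = sl_op {..<n} E x i" if "i < n" for i
      using that unfolding sl_op_def by (intro sum.cong) (auto simp: v_def nbrs_def)
    then have "A *\<^sub>v v = k \<cdot>\<^sub>v v" using mv[OF v] x A v by (intro eq_vecI) (auto simp: v_def)
    moreover have "v \<noteq> 0\<^sub>v n" using x(1) by (auto simp: v_def) (metis index_vec index_zero_vec(1))
    ultimately show "eigenvalue A k" using A v by (auto simp: eigenvalue_def eigenvector_def)
  qed
  \<comment> \<open>\<open>Max\<close> is meaningful only on a finite set; the eigenvalues are the
    roots of a nonzero polynomial.\<close>
  have cp: "char_poly A \<noteq> 0" using degree_monic_char_poly[OF A] n by auto
  have "{k. eigenvalue A k} = {k. poly (char_poly A) k = 0}"
    using eigenvalue_root_char_poly[OF A] by auto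
  then have fin: "finite {k. eigenvalue A k}" using poly_roots_finite[OF cp] by simp
  obtain x where x: "(\<Sum>u<n. (x u)\<^sup>2) = 1" "\<And>u. u < n \<Longrightarrow> sl_op {..<n} E x u = q_max {..<n} E * x u"
    using perron_vector[OF gr] n by (metis lessThan_iff lessThan_empty_iff less_nat_zero_code)
  have "\<exists>i<n. x i \<noteq> 0"
  proof (rule ccontr)
    assume "\<not> ?thesis"
    then have "(\<Sum>u<n. (x u)\<^sup>2) = 0" by (intro sum.neutral) auto
    with x show False by simp
  qed
  then have "eigenvalue A (q_max {..<n} E)" unfolding eig using x by blast
  moreover have "k \<le> q_max {..<n} E" if k: "eigenvalue A k" for k
  proof -
    obtain y where y: "\<exists>i<n. y i \<noteq> 0" "\<forall>i<n. sl_op {..<n} E y i = k * y i" using iffD1[OF eig k] by blast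
    have "sl_form {..<n} E y = k * (\<Sum>u<n. (y u)\<^sup>2)"
      unfolding sl_form_eq[OF gr] sum_distrib_left using y(2)
      by (intro sum.cong refl) (simp add: power2_eq_square)
    moreover have "(\<Sum>u<n. (y u)\<^sup>2) > 0"
    proof -
      obtain i where "i < n" "y i \<noteq> 0" using y(1) by blast
      then show ?thesis by (intro sum_pos2[of _ i]) auto
    qed
    ultimately show ?thesis using sl_form_le_q_max[OF gr, of y] by simp
  qed
  ultimately show ?thesis unfolding q_index_def A_def[symmetric] using fin by (intro Max_eqI) auto
qed

section \<open>Dense graphs without large books\<close>

definition clique_on :: "'a set \<Rightarrow> ('a \<Rightarrow> 'a \<Rightarrow> bool) \<Rightarrow> 'a set \<Rightarrow> bool" where
  "clique_on W E S \<longleftrightarrow> S \<subseteq> W \<and> (\<forall>u\<in>S. \<forall>v\<in>S. u \<noteq> v \<longrightarrow> E u v)"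

text \<open>Union bound: a vertex of \<open>X\<close> outside the common neighbourhood is missed by
  some \<open>u\<close> in \<open>S\<close>.\<close>

lemma card_le_common_nbrs:
  assumes "finite X" "finite S"
  shows "card X \<le> card {w\<in>X. \<forall>u\<in>S. E u w} + (\<Sum>u\<in>S. card {w\<in>X. \<not> E u w})"
proof -
  have "card X \<le> card ({w\<in>X. \<forall>u\<in>S. E u w} \<union> (\<Union>u\<in>S. {w\<in>X. \<not> E u w}))"
    using assms by (intro card_mono) auto
  also have "\<dots> \<le> card {w\<in>X. \<forall>u\<in>S. E u w} + card (\<Union>u\<in>S. {w\<in>X. \<not> E u w})"
    by (rule card_Un_le)
  also have "card (\<Union>u\<in>S. {w\<in>X. \<not> E u w}) \<le> (\<Sum>u\<in>S. card {w\<in>X. \<not> E u w})"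
    using assms by (intro card_UN_le) auto
  finally show ?thesis by simp
qed

lemma card_le_common_nbrs_real:
  fixes s :: real
  assumes "finite X" "finite S" "\<And>u. u \<in> S \<Longrightarrow> real (card {w\<in>X. \<not> E u w}) \<le> s"
  shows "real (card X) \<le> real (card {w\<in>X. \<forall>u\<in>S. E u w}) + real (card S) * s"
proof -
  have "real (card X) \<le> real (card {w\<in>X. \<forall>u\<in>S. E u w}) + (\<Sum>u\<in>S. real (card {w\<in>X. \<not> E u w}))"
    using card_le_common_nbrs[OF assms(1,2), of E] by (simp flip: of_nat_sum of_nat_add)
  also have "(\<Sum>u\<in>S. real (card {w\<in>X. \<not> E u w})) \<le> (\<Sum>u\<in>S. s)"
    using assms(3) by (rule sum_mono)
  finally show ?thesis by simp
qed

text \<open>Greedy choice, one class at a time: each vertex chosen so far excludes at most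
  \<open>s\<close> candidates of the next class, which has more than
  \<open>card J * s\<close>.\<close>

lemma clique_transversal:
  fixes s :: real
  assumes "finite J" "s \<ge> 0"
    and fin: "\<And>j. j \<in> J \<Longrightarrow> finite (X j)"
    and large: "\<And>j. j \<in> J \<Longrightarrow> real (card (X j)) > real (card J) * s"
    and sym: "\<And>j l u w. j \<in> J \<Longrightarrow> l \<in> J \<Longrightarrow> u \<in> X j \<Longrightarrow> w \<in> X l \<Longrightarrow> E u w \<Longrightarrow> E w u"
    and non: "\<And>j l u. j \<in> J \<Longrightarrow> l \<in> J \<Longrightarrow> j \<noteq> l \<Longrightarrow> u \<in> X j \<Longrightarrow> real (card {w\<in>X l. \<not> E u w}) \<le> s"
  shows "\<exists>f. (\<forall>j\<in>J. f j \<in> X j) \<and> (\<forall>j\<in>J. \<forall>l\<in>J. j \<noteq> l \<longrightarrow> E (f j) (f l))"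
  using assms(1) fin large sym non
proof (induction J rule: finite_induct)
  case empty
  then show ?case by simp
next
  case (insert a J)
  have mono: "real (card J) * s \<le> real (card (insert a J)) * s"
    using insert.hyps \<open>s \<ge> 0\<close> by (intro mult_right_mono) auto
  have "\<exists>f. (\<forall>j\<in>J. f j \<in> X j) \<and> (\<forall>j\<in>J. \<forall>l\<in>J. j \<noteq> l \<longrightarrow> E (f j) (f l))"
  proof (rule insert.IH)
    show "real (card J) * s < real (card (X j))" if "j \<in> J" for j
      using insert.prems(2)[of j] that mono by simp
    show "E w u" if "j \<in> J" "l \<in> J" "u \<in> X j" "w \<in> X l" "E u w" for j l u w
      using insert.prems(3)[of j l u w] that by simp
    show "real (card {w\<in>X l. \<not> E u w}) \<le> s" if "j \<in> J" "l \<in> J" "j \<noteq> l" "u \<in> X j" for j l u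
      using insert.prems(4)[of j l u] that by simp
  qed (use insert.prems(1) in simp)
  then obtain f where f: "\<forall>j\<in>J. f j \<in> X j" "\<forall>j\<in>J. \<forall>l\<in>J. j \<noteq> l \<longrightarrow> E (f j) (f l)"
    by blast
  have "real (card {w\<in>X a. \<not> E u w}) \<le> s" if "u \<in> f ` J" for u
  proof -
    obtain j where "j \<in> J" "u = f j" using \<open>u \<in> f ` J\<close> by blast
    then show ?thesis using f(1) insert.hyps insert.prems(4)[of j a u] by auto
  qed
  then have "real (card (X a)) \<le> real (card {w\<in>X a. \<forall>u\<in>f ` J. E u w}) + real (card (f ` J)) * s"
    using insert by (intro card_le_common_nbrs_real) auto
  moreover have "real (card (f ` J)) * s \<le> real (card (insert a J)) * s"
    using insert.hyps \<open>s \<ge> 0\<close> card_image_le[of J f] by (intro mult_right_mono) auto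
  ultimately have "card {w\<in>X a. \<forall>u\<in>f ` J. E u w} \<noteq> 0"
    using insert.prems(2)[of a] by auto
  then obtain w where w: "w \<in> X a" "\<forall>u\<in>f ` J. E u w"
    by (metis (mono_tags, lifting) all_not_in_conv card.empty mem_Collect_eq)
  have "E w (f j)" if "j \<in> J" for j
    using insert.prems(3)[of j a "f j" w] that f w by auto
  then show ?case using f w insert.hyps
    by (intro exI[of _ "f(a := w)"]) auto
qed

text \<open>Greedy extension: a clique of size \<open>i\<close> excludes at most
  \<open>i * d\<close> vertices, so a common neighbour remains.\<close>

lemma clique_of_min_degree:
  fixes d :: real
  assumes gr: "graph_on W E"
    and non: "\<And>v. v \<in> W \<Longrightarrow> real (card {w\<in>W. \<not> E v w}) \<le> d" and "d \<ge> 0"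
    and large: "\<And>i. i < k \<Longrightarrow> real (card W) > real i * d"
  shows "\<exists>S. clique_on W E S \<and> finite S \<and> card S = k"
  using large
proof (induction k)
  case 0
  show ?case by (intro exI[of _ "{}"]) (simp add: clique_on_def)
next
  case (Suc k)
  then obtain S where S: "clique_on W E S" "finite S" "card S = k"
    by (meson less_SucI)
  have "real (card W) \<le> real (card {w\<in>W. \<forall>u\<in>S. E u w}) + real (card S) * d"
    using S non gr by (intro card_le_common_nbrs_real) (auto simp: clique_on_def graph_on_def)
  then have "card {w\<in>W. \<forall>u\<in>S. E u w} \<noteq> 0" using Suc.prems[of k] S by auto
  then obtain w where w: "w \<in> W" "\<forall>u\<in>S. E u w"
    by (metis (mono_tags, lifting) all_not_in_conv card.empty mem_Collect_eq)
  have "w \<notin> S" using w gr by (auto simp: graph_on_def)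
  moreover have "\<forall>u\<in>S. E w u" using w gr S by (auto simp: graph_on_def clique_on_def)
  ultimately show ?case using S w
    by (intro exI[of _ "insert w S"]) (auto simp: clique_on_def)
qed

text \<open>The clique \<open>Q\<close> is completed to a \<open>k\<close>-clique by one vertex from
  each class in \<open>J\<close>; class \<open>l\<close> supplies the pages. The fewer than
  \<open>k\<close> transversal vertices exclude at most \<open>k * s\<close> elements of
  \<open>X l\<close>, which leaves at least \<open>b\<close> pages.\<close>

lemma no_book_no_transversal:
  fixes b s :: real
  assumes gr: "graph_on W E" and b: "b > 0" and s: "s \<ge> 0"
    and book: "\<And>S. clique_on W E S \<Longrightarrow> card S = k \<Longrightarrow> real (card {w\<in>W. \<forall>u\<in>S. E u w}) < b"
    and A: "\<And>j. j < k \<Longrightarrow> A j \<subseteq> W"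
    and non: "\<And>j l u. j < k \<Longrightarrow> l < k \<Longrightarrow> j \<noteq> l \<Longrightarrow> u \<in> A j \<Longrightarrow> real (card {w\<in>A l. \<not> E u w}) \<le> s"
    and Q: "clique_on W E Q" and J: "J \<subseteq> {..<k}" and l: "l < k" "l \<notin> J" and QJ: "card Q + card J = k"
    and X: "\<And>j. j \<in> insert l J \<Longrightarrow> X j \<subseteq> A j"
    and XQ: "\<And>j u w. j \<in> insert l J \<Longrightarrow> u \<in> Q \<Longrightarrow> w \<in> X j \<Longrightarrow> E u w"
    and large: "\<And>j. j \<in> insert l J \<Longrightarrow> real (card (X j)) \<ge> b + real k * s"
  shows False
proof -
  have fJ: "finite J" using J finite_subset by blast
  have XW: "X j \<subseteq> W" if "j \<in> insert l J" for j
    using X[OF that] A[of j] J l(1) that by blast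
  have finX: "finite (X j)" if "j \<in> insert l J" for j
    using XW[OF that] gr by (auto simp: graph_on_def intro: finite_subset)
  have nonX: "real (card {w\<in>X i. \<not> E u w}) \<le> s" 
    if "j \<in> J" "i \<in> insert l J" "j \<noteq> i" "u \<in> X j" for j i u
  proof -
    have "finite (A i)" using A[of i] that J l gr by (auto simp: graph_on_def intro: finite_subset)
    then have "card {w\<in>X i. \<not> E u w} \<le> card {w\<in>A i. \<not> E u w}"
      using X[OF that(2)] by (intro card_mono) auto
    moreover have "real (card {w\<in>A i. \<not> E u w}) \<le> s"
      using non[of j i u] that J l X[of j] by blast
    ultimately show ?thesis by linarith
  qed
  have Jk: "real (card J) * s \<le> real k * s" using QJ s by (intro mult_right_mono) auto
  have "\<exists>f. (\<forall>j\<in>J. f j \<in> X j) \<and> (\<forall>j\<in>J. \<forall>i\<in>J. j \<noteq> i \<longrightarrow> E (f j) (f i))"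
  proof (rule clique_transversal[where s = s])
    show "real (card J) * s < real (card (X j))" if "j \<in> J" for j
      using large[of j] that Jk b by simp
    show "E w u" if "j \<in> J" "i \<in> J" "u \<in> X j" "w \<in> X i" "E u w" for j i u w
      using XW[of j] XW[of i] that gr by (auto simp: graph_on_def)
  qed (use fJ s finX nonX in auto)
  then obtain f where f: "\<And>j. j \<in> J \<Longrightarrow> f j \<in> X j"
      "\<And>j i. j \<in> J \<Longrightarrow> i \<in> J \<Longrightarrow> j \<noteq> i \<Longrightarrow> E (f j) (f i)" by blast
  have fW: "f j \<in> W" if "j \<in> J" for j using f(1)[OF that] XW[of j] that by auto
  have irr: "\<not> E u u" if "u \<in> W" for u using gr that by (auto simp: graph_on_def)
  have Qf: "E u (f j)" "E (f j) u" if "u \<in> Q" "j \<in> J" for u j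
  proof -
    show *: "E u (f j)" using XQ[of j u "f j"] f that by auto
    show "E (f j) u" using * that gr fW[of j] Q by (auto simp: graph_on_def clique_on_def)
  qed
  have inj: "inj_on f J" using f(2) irr fW by (metis inj_onI)
  have disj: "Q \<inter> f ` J = {}" using Qf(1) irr fW by fastforce
  have finQ: "finite Q" using Q gr by (auto simp: graph_on_def clique_on_def intro: finite_subset)
  define S where "S = Q \<union> f ` J"
  have "card S = k" using disj finQ fJ inj QJ by (simp add: S_def card_Un_disjoint card_image)
  moreover have "clique_on W E S" using Q fW Qf f(2) by (auto simp: clique_on_def S_def) metis
  ultimately have "real (card {w\<in>W. \<forall>u\<in>S. E u w}) < b" using book by blast
  moreover have "card {w\<in>X l. \<forall>u\<in>f ` J. E u w} \<le> card {w\<in>W. \<forall>u\<in>S. E u w}"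
    using XW[of l] XQ[of l] gr by (intro card_mono) (auto simp: S_def graph_on_def)
  moreover have "real (card (X l)) \<le> real (card {w\<in>X l. \<forall>u\<in>f ` J. E u w}) + real (card (f ` J)) * s"
    using finX[of l] fJ nonX f l by (intro card_le_common_nbrs_real) auto
  moreover have "card (f ` J) = card J" using inj by (rule card_image)
  ultimately show False using large[of l] Jk by simp
qed

text \<open>Fixing one \<open>k\<close>-clique \<open>v 0, \<dots>, v (k - 1)\<close>, the classes \<open>A i\<close> collect the vertices whose only
  non-neighbour in the clique is \<open>v i\<close>.\<close>

lemma near_partition:
  fixes b :: real
  assumes gr: "graph_on W E" and k: "k \<ge> 1" and b: "b > 0"
    and large: "real (card W) / real k > real k * b"
    and non: "\<And>u. u \<in> W \<Longrightarrow> real (card {w\<in>W. \<not> E u w}) \<le> real (card W) / real k + b"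
    and book: "\<And>S. clique_on W E S \<Longrightarrow> card S = k \<Longrightarrow> real (card {w\<in>W. \<forall>u\<in>S. E u w}) < b"
  shows "\<exists>A. (\<forall>i<k. A i \<subseteq> W \<and> real (card (A i)) \<ge> real (card W) / real k - real k * b) \<and>
    (\<forall>i<k. \<forall>j<k. i \<noteq> j \<longrightarrow> A i \<inter> A j = {} \<and>
      (\<forall>u\<in>A i. real (card {w\<in>A j. \<not> E u w}) \<le> (real k + 2) * b))"
proof -
  define M where "M = real (card W) / real k"
  have m: "real (card W) = real k * M" using k by (simp add: M_def)
  have fin: "finite W" using gr by (simp add: graph_on_def)
  have irr: "\<not> E u u" if "u \<in> W" for u using gr that by (auto simp: graph_on_def)
  have sym: "E v u" if "u \<in> W" "v \<in> W" "E u v" for u v using gr that by (auto simp: graph_on_def)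
  have M: "M > real k * b" "M \<ge> 0" using large by (auto simp: M_def)
  have "\<exists>S. clique_on W E S \<and> finite S \<and> card S = k"
  proof (rule clique_of_min_degree[OF gr non])
    show "0 \<le> real (card W) / real k + b" using b by simp
    fix i assume i: "i < k"
    have "real i * (M + b) \<le> (real k - 1) * (M + b)"
      using i b M by (intro mult_right_mono) auto
    also have "\<dots> = real k * M + real k * b - b - M" by (simp add: algebra_simps)
    also have "\<dots> < real k * M" using M b by linarith
    finally show "real i * (real (card W) / real k + b) < real (card W)" 
      unfolding m M_def[symmetric] using k by simp
  qed
  then obtain S where S: "clique_on W E S" "finite S" "card S = k" by blast
  obtain v where v: "bij_betw v {..<k} S"
    using ex_bij_betw_nat_finite[OF S(2)] S(3) by (auto simp: lessThan_atLeast0)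
  have vW: "v i \<in> W" if "i < k" for i
    using v S(1) that by (auto simp: clique_on_def bij_betw_def)
  have vE: "E (v i) (v j)" if "i < k" "j < k" "v i \<noteq> v j" for i j
    using v S(1) that by (auto simp: clique_on_def bij_betw_def)
  define A where "A = (\<lambda>i. {u\<in>W. (\<forall>j<k. j \<noteq> i \<longrightarrow> E (v j) u) \<and> \<not> E (v i) u})"
  \<comment> \<open>\<open>C\<close> holds the pages of the book on the fixed clique, so it has
    fewer than \<open>b\<close> elements.\<close>
  define C where "C = {u\<in>W. \<forall>j<k. E (v j) u}"
  have C: "real (card C) < b"
  proof -
    have "C = {w\<in>W. \<forall>u\<in>S. E u w}" using v by (auto simp: C_def bij_betw_def)
    then show ?thesis using book[OF S(1,3)] by simp
  qed
  have nonv: "real (card {u\<in>W. \<not> E (v j) u}) \<le> M + b" if "j < k" for j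
    using non[OF vW[OF that]] by (simp add: M_def)
  have Acard: "real (card (A i)) \<ge> M - real k * b" if i: "i < k" for i
  proof -
    \<comment> \<open>A vertex outside \<open>C\<close> and \<open>A i\<close> is missed by some
      \<open>v j\<close> with \<open>j \<noteq> i\<close>. Those \<open>k - 1\<close> sets have at
      most \<open>M + b\<close> elements each, and
      \<open>k * M - b - (k - 1) * (M + b) = M - k * b\<close>.\<close>
    have "card W \<le> card (C \<union> A i \<union> (\<Union>j\<in>{..<k} - {i}. {u\<in>W. \<not> E (v j) u}))"
      using fin i by (intro card_mono) (auto simp: C_def A_def)
    also have "\<dots> \<le> card C + card (A i) + card (\<Union>j\<in>{..<k} - {i}. {u\<in>W. \<not> E (v j) u})"
      using card_Un_le[of "C \<union> A i"] card_Un_le[of C "A i"] by (meson add_le_cancel_right order_trans)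
    also have "card (\<Union>j\<in>{..<k} - {i}. {u\<in>W. \<not> E (v j) u}) \<le> (\<Sum>j\<in>{..<k} - {i}. card {u\<in>W. \<not> E (v j) u})"
      by (intro card_UN_le) auto
    finally have "real (card W) \<le> real (card C) + real (card (A i)) + (\<Sum>j\<in>{..<k} - {i}. real (card {u\<in>W. \<not> E (v j) u}))"
      by (simp flip: of_nat_sum of_nat_add)
    also have "(\<Sum>j\<in>{..<k} - {i}. real (card {u\<in>W. \<not> E (v j) u})) \<le> (\<Sum>j\<in>{..<k} - {i}. M + b)"
      using nonv by (intro sum_mono) auto
    also have "\<dots> = (real k - 1) * (M + b)" using i k by (simp add: of_nat_diff)
    finally show ?thesis using C m by (simp add: algebra_simps)
  qed
  have Ai: "real (card {w\<in>A i. E u w}) < b" if i: "i < k" and u: "u \<in> A i" for i u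
  proof -
    \<comment> \<open>Replacing \<open>v i\<close> by \<open>u\<close> gives another
      \<open>k\<close>-clique, and every neighbour of \<open>u\<close> inside \<open>A i\<close> is
      a page of its book.\<close>
    define S' where "S' = insert u (v ` ({..<k} - {i}))"
    have uv: "E (v j) u" "E u (v j)" "v j \<noteq> u" if "j < k" "j \<noteq> i" for j
      using u that sym[OF vW[of j], of u] irr[of u] by (auto simp: A_def)
    have "inj_on v ({..<k} - {i})" using v by (auto simp: bij_betw_def intro: inj_on_subset)
    then have "card S' = k"
      using uv(3) i by (subst S'_def, subst card_insert_disjoint) (auto simp: card_image)
    moreover have "clique_on W E S'"
      using uv u vW vE by (auto simp: clique_on_def S'_def A_def)
    ultimately have "real (card {w\<in>W. \<forall>u\<in>S'. E u w}) < b" using book by blast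
    moreover have "card {w\<in>A i. E u w} \<le> card {w\<in>W. \<forall>u\<in>S'. E u w}"
      using fin by (intro card_mono) (auto simp: S'_def A_def)
    ultimately show ?thesis by linarith
  qed
  have disj: "A i \<inter> A j = {}" if "i < k" "j < k" "i \<noteq> j" for i j
    using that by (auto simp: A_def)
  have AW: "A i \<subseteq> W" for i by (auto simp: A_def)
  have finA: "finite (A i)" for i using AW fin by (rule finite_subset)
  \<comment> \<open>Of its at most \<open>M + b\<close> non-neighbours, \<open>u\<close> already
    spends more than \<open>M - k * b - b\<close> inside its own class.\<close>
  have cross: "real (card {w\<in>A j. \<not> E u w}) \<le> (real k + 2) * b"
    if ij: "i < k" "j < k" "i \<noteq> j" and u: "u \<in> A i" for i j u
  proof -
    have "card (A i) = card {w\<in>A i. \<not> E u w} + card {w\<in>A i. E u w}"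
      using finA by (subst card_Un_disjoint[symmetric]) (auto intro!: arg_cong[of _ _ card])
    moreover have "card {w\<in>A j. \<not> E u w} + card {w\<in>A i. \<not> E u w} = card ({w\<in>A j. \<not> E u w} \<union> {w\<in>A i. \<not> E u w})"
      using finA disj[OF ij] by (subst card_Un_disjoint) auto
    moreover have "\<dots> \<le> card {w\<in>W. \<not> E u w}" using AW fin by (intro card_mono) auto
    ultimately have "real (card {w\<in>A j. \<not> E u w}) + real (card (A i)) \<le> real (card {w\<in>W. \<not> E u w}) + real (card {w\<in>A i. E u w})"
      by linarith
    moreover have "real (card {w\<in>W. \<not> E u w}) \<le> M + b" using non[of u] u AW by (auto simp: M_def)
    ultimately show ?thesis using Ai[OF ij(1) u] Acard[OF ij(1)] by (simp add: algebra_simps)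
  qed
  show ?thesis using AW disj Acard cross unfolding M_def by (intro exI[of _ A]) blast
qed

text \<open>Each vertex has few neighbours in some class of the near-partition, and that class is
  its colour. Its non-neighbours are then almost exhausted by this class, so it sees nearly all of
  the others. Two adjacent vertices of one colour would extend through the other classes to a
  \<open>k\<close>-clique with a large book.\<close>

lemma k_partite_of_min_degree:
  fixes b :: real
  assumes gr: "graph_on W E" and k: "k \<ge> 2" and b: "b > 0"
    and large: "real (card W) / real k \<ge> 3 * (real k + 1) * (real k + 2) * b"
    and non: "\<And>u. u \<in> W \<Longrightarrow> real (card {w\<in>W. \<not> E u w}) \<le> real (card W) / real k + b"
    and book: "\<And>S. clique_on W E S \<Longrightarrow> card S = k \<Longrightarrow> real (card {w\<in>W. \<forall>u\<in>S. E u w}) < b"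
  shows "\<exists>p. (\<forall>u\<in>W. p u < k) \<and> (\<forall>u\<in>W. \<forall>w\<in>W. E u w \<longrightarrow> p u \<noteq> p w)"
proof -
  define M where "M = real (card W) / real k"
  \<comment> \<open>This is the class size that \<open>no_book_no_transversal\<close> asks for with
    \<open>s = (k + 2) * b\<close>.\<close>
  define \<theta> where "\<theta> = b + real k * ((real k + 2) * b)"
  have kb: "real k * b \<ge> 0" "real k * (real k * b) \<ge> 0" "real k * ((real k + 2) * b) \<ge> 0" using b by auto
  have fin: "finite W" using gr by (simp add: graph_on_def)
  \<comment> \<open>The right-hand side of \<open>large\<close> equals this sum. Two vertices of one
    colour miss at most \<open>2 * ((k + 1) * b + \<theta>)\<close> of a class of size
    \<open>M - k * b\<close>, and \<open>\<theta>\<close> must remain; the last \<open>b\<close>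
    makes \<open>M > k * b\<close> strict.\<close>
  have M: "M \<ge> 2 * b + 3 * (real k * b) + 3 * \<theta> + b" 
    using large unfolding M_def[symmetric] by (simp add: \<theta>_def algebra_simps)
  have "\<theta> \<ge> 0" using b kb by (simp add: \<theta>_def)
  then have "M > real k * b" using M b kb(1) by linarith
  then have largeM: "real (card W) / real k > real k * b" by (simp add: M_def)
  have "k \<ge> 1" using k by simp
  obtain A where A': "\<forall>i<k. A i \<subseteq> W \<and> real (card (A i)) \<ge> real (card W) / real k - real k * b"
    "\<forall>i<k. \<forall>j<k. i \<noteq> j \<longrightarrow> A i \<inter> A j = {} \<and>
      (\<forall>u\<in>A i. real (card {w\<in>A j. \<not> E u w}) \<le> (real k + 2) * b)"
    using near_partition[OF gr \<open>k \<ge> 1\<close> b largeM non book] by blast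
  have A: "A i \<subseteq> W" and Acard: "real (card (A i)) \<ge> M - real k * b" if "i < k" for i
    using A'(1) that by (auto simp: M_def)
  have disj: "A i \<inter> A j = {}" if "i < k" "j < k" "i \<noteq> j" for i j
    using A'(2) that by blast
  have cross: "real (card {w\<in>A j. \<not> E u w}) \<le> (real k + 2) * b" if "i < k" "j < k" "i \<noteq> j" "u \<in> A i" for i j u
    using A'(2) that by blast
  have finA: "finite (A i)" if "i < k" for i using A[OF that] fin by (rule finite_subset)
  have s: "0 \<le> (real k + 2) * b" using b by simp
  note no_trans = no_book_no_transversal[OF gr b s book A cross]
  \<comment> \<open>Otherwise \<open>u\<close> and a transversal of the first \<open>k - 1\<close>
    classes inside its neighbourhood form a \<open>k\<close>-clique with too many pages in the last
    class.\<close>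
  have colour: "\<exists>i<k. real (card {w\<in>A i. E u w}) < \<theta>" if u: "u \<in> W" for u
  proof (rule ccontr)
    assume *: "\<not> ?thesis"
    show False
    proof (rule no_trans[where Q = "{u}" and J = "{..<k - 1}" and l = "k - 1" and X = "\<lambda>i. {w\<in>A i. E u w}"])
      show "b + real k * ((real k + 2) * b) \<le> real (card {w\<in>A j. E u w})" if "j \<in> insert (k - 1) {..<k - 1}" for j
      proof -
        have "j < k" using that k by auto
        then have "\<theta> \<le> real (card {w\<in>A j. E u w})" using * by (meson not_less)
        then show ?thesis by (simp only: \<theta>_def)
      qed
    qed (use u k in \<open>auto simp: clique_on_def\<close>)
  qed
  define p where "p = (\<lambda>u. SOME i. i < k \<and> real (card {w\<in>A i. E u w}) < \<theta>)"
  have p: "p u < k \<and> real (card {w\<in>A (p u). E u w}) < \<theta>" if "u \<in> W" for u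
    unfolding p_def by (rule someI_ex) (use colour[OF that] in blast)
  have nonout: "real (card {w\<in>A j. \<not> E u w}) \<le> (real k + 1) * b + \<theta>" if u: "u \<in> W" and j: "j < k" "j \<noteq> p u" for u j
  proof -
    have fins: "finite (A j)" "finite (A (p u))" using finA p[OF u] j by auto
    have "card (A (p u)) = card {w\<in>A (p u). \<not> E u w} + card {w\<in>A (p u). E u w}"
      using fins by (subst card_Un_disjoint[symmetric]) (auto intro!: arg_cong[of _ _ card])
    moreover have "card {w\<in>A j. \<not> E u w} + card {w\<in>A (p u). \<not> E u w} = card ({w\<in>A j. \<not> E u w} \<union> {w\<in>A (p u). \<not> E u w})"
      using fins disj[of j "p u"] j p[OF u] by (subst card_Un_disjoint) auto
    moreover have "\<dots> \<le> card {w\<in>W. \<not> E u w}"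
      using A[of j] A[of "p u"] j p[OF u] fin by (intro card_mono) auto
    ultimately have "real (card {w\<in>A j. \<not> E u w}) + real (card (A (p u))) \<le> real (card {w\<in>W. \<not> E u w}) + real (card {w\<in>A (p u). E u w})"
      by linarith
    moreover have "real (card {w\<in>W. \<not> E u w}) \<le> M + b" using non[OF u] by (simp add: M_def)
    ultimately show ?thesis using p[OF u] Acard[of "p u"] by (simp add: algebra_simps)
  qed
  have "p u \<noteq> p w" if u: "u \<in> W" and w: "w \<in> W" and uw: "E u w" for u w
  proof
    assume eq: "p u = p w"
    \<comment> \<open>Any class other than the common colour can hold the pages. The
      \<open>k - 2\<close> classes left over, together with \<open>u\<close> and \<open>w\<close>,
      make up the \<open>k\<close>-clique.\<close>
    define l where "l = (if p u = 0 then 1 else 0 :: nat)"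
    have l: "l < k" "l \<noteq> p u" using k by (auto simp: l_def)
    have "u \<noteq> w" "E w u" using uw u w gr by (auto simp: graph_on_def)
    show False
    proof (rule no_trans[where Q = "{u, w}" and J = "{..<k} - {p u, l}" and l = l and X = "\<lambda>i. {y\<in>A i. \<forall>x\<in>{u, w}. E x y}"])
      show "clique_on W E {u, w}" using u w uw \<open>E w u\<close> by (auto simp: clique_on_def)
      have "card ({..<k} - {p u, l}) = k - 2"
        using l p[OF u] by (subst card_Diff_subset) auto
      then show "card {u, w} + card ({..<k} - {p u, l}) = k" using \<open>u \<noteq> w\<close> k by simp
      fix j assume "j \<in> insert l ({..<k} - {p u, l})"
      then have j: "j < k" "j \<noteq> p u" using l by auto
      have "real (card (A j)) \<le> real (card {y\<in>A j. \<forall>x\<in>{u, w}. E x y}) + real (card {u, w}) * ((real k + 1) * b + \<theta>)"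
        using nonout[OF u j] nonout[OF w] j eq finA by (intro card_le_common_nbrs_real) auto
      then show "b + real k * ((real k + 2) * b) \<le> real (card {y\<in>A j. \<forall>x\<in>{u, w}. E x y})"
        using Acard[OF j(1)] M b \<open>u \<noteq> w\<close> unfolding \<theta>_def[symmetric] by (simp add: algebra_simps)
    qed (use l in auto)
  qed
  then show ?thesis using p by blast
qed

section \<open>Deleting a vertex with minimal Perron entry\<close>

text \<open>An edge at \<open>u\<close> occurs once in the row of \<open>u\<close> and once in the
  row of its other end, which cancels the factor 1/2.\<close>

lemma sl_form_delete:
  assumes gr: "graph_on W E" and u: "u \<in> W"
  shows "sl_form W E x = sl_form (W - {u}) E x + (\<Sum>v\<in>nbrs W E u. (x u + x v)\<^sup>2)"
proof -
  define V where "V = W - {u}"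
  have fin: "finite W" "finite V" using gr by (auto simp: graph_on_def V_def)
  have "(\<Sum>a\<in>W. \<Sum>v\<in>nbrs W E a. (x a + x v)\<^sup>2) =
      (\<Sum>v\<in>nbrs W E u. (x u + x v)\<^sup>2) + (\<Sum>a\<in>V. \<Sum>v\<in>nbrs W E a. (x a + x v)\<^sup>2)"
    using fin u by (simp add: V_def sum.remove[of W u])
  also have "(\<Sum>a\<in>V. \<Sum>v\<in>nbrs W E a. (x a + x v)\<^sup>2) =
      (\<Sum>a\<in>V. (\<Sum>v\<in>nbrs V E a. (x a + x v)\<^sup>2) + (if E a u then (x a + x u)\<^sup>2 else 0))"
  proof (intro sum.cong refl)
    fix a
    have "nbrs W E a = nbrs V E a \<union> (if E a u then {u} else {})" "u \<notin> nbrs V E a"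
      using u by (auto simp: nbrs_def V_def)
    then show "(\<Sum>v\<in>nbrs W E a. (x a + x v)\<^sup>2) =
        (\<Sum>v\<in>nbrs V E a. (x a + x v)\<^sup>2) + (if E a u then (x a + x u)\<^sup>2 else 0)"
      using fin by (simp add: add.commute)
  qed
  also have "\<dots> = (\<Sum>a\<in>V. \<Sum>v\<in>nbrs V E a. (x a + x v)\<^sup>2) + (\<Sum>a\<in>{a\<in>V. E a u}. (x a + x u)\<^sup>2)"
    using fin by (simp add: sum.distrib sum.inter_filter)
  also have "{a\<in>V. E a u} = nbrs W E u" using gr u by (auto simp: nbrs_def V_def graph_on_def)
  finally show ?thesis by (simp add: sl_form_def V_def add.commute)
qed

text \<open>The deleted vertex \<open>u\<close> has the least Perron entry, with square
  \<open>y\<close>; it may differ from \<open>v\<close>, whose degree \<open>d\<close> serves to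
  bound \<open>y\<close>. Cauchy-Schwarz in the eigenvalue equation at \<open>v\<close> gives that
  bound, and the Perron vector restricted to \<open>W - {u}\<close> is the test vector for the
  remaining graph.\<close>

lemma delete_min_entry:
  assumes gr: "graph_on W E" and v: "v \<in> W"
  defines "q \<equiv> q_max W E" and "m \<equiv> real (card W)" and "d \<equiv> real (card (nbrs W E v))"
  obtains u y where "u \<in> W" "y \<ge> 0" "m * y \<le> 1" "y * ((q - d)\<^sup>2 + d * (m - d)) \<le> d"
    "q_max (W - {u}) E * (1 - y) \<ge> q - 1 - (2 * q - m) * y"
proof -
  have fin: "finite W" using gr by (simp add: graph_on_def)
  obtain x where x: "\<And>u. x u \<ge> 0" "(\<Sum>u\<in>W. (x u)\<^sup>2) = 1" "sl_form W E x = q"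
    "\<And>u. u \<in> W \<Longrightarrow> sl_op W E x u = q * x u"
    using perron_vector[OF gr] v unfolding q_def by blast
  define u where "u = arg_min_on x W"
  have u: "u \<in> W" "\<And>w. w \<in> W \<Longrightarrow> x u \<le> x w"
    using arg_min_if_finite[OF fin, of x] v arg_min_least[OF fin, of _ x] unfolding u_def by auto
  define y where "y = (x u)\<^sup>2"
  have yle: "y \<le> (x w)\<^sup>2" if "w \<in> W" for w unfolding y_def using u(2)[OF that] x(1) by (simp add: power_mono)
  have "m * y = (\<Sum>w\<in>W. y)" by (simp add: m_def)
  also have "\<dots> \<le> 1" unfolding x(2)[symmetric] using yle by (rule sum_mono)
  finally have my: "m * y \<le> 1" .
  have nsum: "(\<Sum>v\<in>nbrs W E w. x v) = (q - real (card (nbrs W E w))) * x w" if "w \<in> W" for w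
    using x(4)[OF that] by (simp add: sl_op_eq algebra_simps)
  \<comment> \<open>Every vertex outside the neighbourhood carries at least \<open>y\<close> of the
    total mass 1.\<close>
  have nsq: "(\<Sum>v\<in>nbrs W E w. (x v)\<^sup>2) \<le> 1 - (m - real (card (nbrs W E w))) * y" for w
  proof -
    have "(m - real (card (nbrs W E w))) * y = (\<Sum>v\<in>W - nbrs W E w. y)"
      using fin nbrs_subset[of W E w] card_mono[OF fin nbrs_subset, of E w]
      by (simp add: m_def card_Diff_subset finite_subset of_nat_diff)
    also have "\<dots> \<le> (\<Sum>v\<in>W - nbrs W E w. (x v)\<^sup>2)" using yle by (intro sum_mono) auto
    also have "\<dots> = 1 - (\<Sum>v\<in>nbrs W E w. (x v)\<^sup>2)"
      using x(2) fin nbrs_subset[of W E w] by (simp add: sum_diff)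
    finally show ?thesis by simp
  qed
  have "(q - d)\<^sup>2 * y \<le> (q - d)\<^sup>2 * (x v)\<^sup>2" using yle[OF v] by (intro mult_left_mono) auto
  also have "\<dots> = (\<Sum>w\<in>nbrs W E v. x w)\<^sup>2" by (simp add: nsum[OF v] d_def power_mult_distrib)
  also have "\<dots> \<le> d * (\<Sum>w\<in>nbrs W E v. (x w)\<^sup>2)"
    using Cauchy_Schwarz_ineq_sum[of "\<lambda>_. 1" x "nbrs W E v"] by (simp add: d_def)
  also have "\<dots> \<le> d * (1 - (m - d) * y)"
    using nsq[of v] by (intro mult_left_mono) (auto simp: d_def)
  finally have bd: "y * ((q - d)\<^sup>2 + d * (m - d)) \<le> d" by (simp add: algebra_simps)
  \<comment> \<open>The degree \<open>e\<close> of \<open>u\<close> cancels in the end, so nothing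
    about it has to be known.\<close>
  define e where "e = real (card (nbrs W E u))"
  have "(\<Sum>v\<in>nbrs W E u. (x u + x v)\<^sup>2) = (\<Sum>v\<in>nbrs W E u. y + 2 * x u * x v + (x v)\<^sup>2)"
    by (intro sum.cong refl) (simp add: y_def power2_eq_square algebra_simps)
  also have "\<dots> = e * y + 2 * x u * (\<Sum>v\<in>nbrs W E u. x v) + (\<Sum>v\<in>nbrs W E u. (x v)\<^sup>2)"
    by (simp add: sum.distrib sum_distrib_left e_def)
  also have "\<dots> = 2 * q * y - e * y + (\<Sum>v\<in>nbrs W E u. (x v)\<^sup>2)"
    by (simp add: nsum[OF u(1)] e_def[symmetric] y_def power2_eq_square algebra_simps)
  also have "\<dots> \<le> 2 * q * y + 1 - m * y"
    using nsq[of u] by (simp add: e_def[symmetric] algebra_simps)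
  finally have "sl_form (W - {u}) E x \<ge> q - 1 - (2 * q - m) * y"
    using sl_form_delete[OF gr u(1), of x] x(3) by (simp add: algebra_simps)
  moreover have "sl_form (W - {u}) E x \<le> q_max (W - {u}) E * (\<Sum>w\<in>W - {u}. (x w)\<^sup>2)"
    by (rule sl_form_le_q_max[OF graph_on_subset[OF gr]]) auto
  moreover have "(\<Sum>w\<in>W - {u}. (x w)\<^sup>2) = 1 - y"
    using x(2) fin u(1) by (simp add: sum_diff1 y_def)
  ultimately show thesis using that[OF u(1) _ my bd] by (simp add: y_def)
qed

text \<open>In the scale \<open>r = q / m\<close>, \<open>D = d / m\<close>,
  \<open>z = m * y\<close>, the low degree forces \<open>z \<le> 1 - \<eta> / 2\<close>. With
  \<open>z = 1\<close> the deletion would preserve the ratio \<open>r\<close> up to lower-order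
  terms; the deficit \<open>\<eta> / 2\<close> turns into growth of order
  \<open>\<eta> / m\<close>.\<close>

lemma q_max_delete_low_degree:
  fixes k :: nat and \<eta> :: real
  assumes gr: "graph_on W E" and v: "v \<in> W" and \<eta>: "0 < \<eta>" "\<eta> \<le> 1 / 12"
    and k: "k \<ge> 3"
    and low: "real (card (nbrs W E v)) \<le> (1 - 1 / real k - \<eta>) * real (card W)"
    and q: "q_max W E \<ge> (2 - 2 / real k - \<eta>) * real (card W)"
    and m: "real (card W) \<ge> 1 + 64 / \<eta>"
  obtains u where "u \<in> W"
    "q_max (W - {u}) E / real (card (W - {u})) \<ge> q_max W E / real (card W) + (\<eta> / 16) / real (card (W - {u}))"
proof -
  define m where "m = real (card W)"
  define r where "r = q_max W E / m"
  define D where "D = real (card (nbrs W E v)) / m"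
  define \<delta> where "\<delta> = \<eta> / 2"
  have m1: "m > 1" "m - 1 \<ge> 64 / \<eta>" 
  proof -
    have "64 / \<eta> > 0" using \<eta> by simp
    then show "m > 1" "m - 1 \<ge> 64 / \<eta>" using m unfolding m_def by linarith+
  qed
  have eq: "q_max W E = r * m" "real (card (nbrs W E v)) = D * m" using m1 by (auto simp: r_def D_def)
  have k3: "1 / real k \<le> 1 / 3" "1 / real k \<ge> 0" using k by (simp add: field_simps) simp
  have D: "0 \<le> D" "D \<le> 1 - 1 / real k - \<eta>" using low m1 by (auto simp: D_def m_def[symmetric] field_simps)
  have r1: "r \<ge> 2 - 2 / real k - \<eta>" using q m1 by (auto simp: r_def m_def[symmetric] field_simps)
  have r2: "r \<le> 2"
    using q_max_le[OF gr] v m1 by (auto simp: r_def m_def[symmetric] field_simps)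
  \<comment> \<open>Here \<open>k \<ge> 3\<close> enters: \<open>2 - 2/3 - 1/12 = 5/4\<close>, so
    \<open>r - 1\<close> stays away from 0.\<close>
  have r54: "r \<ge> 5 / 4" using r1 k3 \<eta> by simp
  obtain u y where u: "u \<in> W" and y: "y \<ge> 0" "m * y \<le> 1"
      "y * ((r * m - D * m)\<^sup>2 + D * m * (m - D * m)) \<le> D * m"
      "q_max (W - {u}) E * (1 - y) \<ge> r * m - 1 - (2 * (r * m) - m) * y"
    using delete_min_entry[OF gr v] unfolding eq m_def[symmetric] by metis
  define z where "z = m * y"
  have "m * (z * ((r - D)\<^sup>2 + D * (1 - D))) \<le> m * D"
    using y(3) by (simp add: z_def power2_eq_square algebra_simps)
  then have z: "z * ((r - D)\<^sup>2 + D * (1 - D)) \<le> D" using m1 by simp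
  have "z \<ge> 0" using y(1) m1 by (simp add: z_def)
  have "(r - D)\<^sup>2 + D * (1 - D) = D + r * (r - 2 * D)" by (simp add: power2_eq_square algebra_simps)
  \<comment> \<open>The bounds on \<open>r\<close> and \<open>D\<close> differ by design:
    \<open>r \<ge> 2 - 2 / k - \<eta>\<close> against
    \<open>2 * D \<le> 2 - 2 / k - 2 * \<eta>\<close>.\<close>
  moreover have "1 * \<eta> \<le> r * (r - 2 * D)" using r1 D r54 \<eta> by (intro mult_mono) auto
  ultimately have "z * (D + \<eta>) \<le> D" using z \<open>z \<ge> 0\<close> mult_left_mono[of "D + \<eta>" "(r - D)\<^sup>2 + D * (1 - D)" z] by linarith
  moreover have "D \<le> (1 - \<delta>) * (D + \<eta>)"
  proof -
    have "\<delta> * (D + \<eta>) \<le> \<delta> * 2" using D \<eta> k3(2) unfolding \<delta>_def by (intro mult_left_mono) linarith+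
    then show ?thesis by (simp add: \<delta>_def algebra_simps)
  qed
  ultimately have "z * (D + \<eta>) \<le> (1 - \<delta>) * (D + \<eta>)" by linarith
  then have z1: "z \<le> 1 - \<delta>" using D \<eta> by simp
  define q' where "q' = q_max (W - {u}) E"
  \<comment> \<open>\<open>\<rho> = 1 + (r - 1) * (1 - \<delta>)\<close> bounds the loss in
    \<open>q\<close> before renormalising by \<open>1 - y\<close>.\<close>
  define \<rho> where "\<rho> = r - \<delta> * (r - 1)"
  have "0 \<le> \<delta> * (r - 1)" "\<delta> * (r - 1) \<le> 1 / 24 * 1"
    using \<eta> r54 r2 unfolding \<delta>_def by (intro mult_nonneg_nonneg mult_mono; simp)+
  then have \<rho>: "0 \<le> \<rho>" "\<rho> \<le> 2" using r54 r2 unfolding \<rho>_def by linarith+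
  have "q' * (1 - y) \<ge> r * m * (1 - y) - 1 - (r - 1) * z"
    using y(4) by (simp add: q'_def z_def algebra_simps)
  moreover have "(r - 1) * z \<le> (r - 1) * (1 - \<delta>)" using z1 r54 by (intro mult_left_mono) auto
  ultimately have "q' * (1 - y) \<ge> r * m * (1 - y) - \<rho>" by (simp add: \<rho>_def algebra_simps)
  moreover have y1: "(1 - y) \<ge> (m - 1) / m" "1 - y > 0"
  proof -
    show "1 - y \<ge> (m - 1) / m" using y(2) m1 by (simp add: field_simps)
    moreover have "(m - 1) / m > 0" using m1 by simp
    ultimately show "1 - y > 0" by linarith
  qed
  ultimately have "q' \<ge> r * m - \<rho> / (1 - y)" by (simp add: field_simps)
  moreover have "\<rho> / (1 - y) \<le> \<rho> / ((m - 1) / m)"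
    using y1 m1 \<rho>(1) by (intro divide_left_mono mult_pos_pos) auto
  ultimately have "q' \<ge> r * m - \<rho> * m / (m - 1)" by simp
  also have "r * m - \<rho> * m / (m - 1) = r * (m - 1) + (r - \<rho>) - \<rho> / (m - 1)"
    using m1 by (simp add: field_simps)
  finally have "q' \<ge> r * (m - 1) + \<delta> * (r - 1) - \<rho> / (m - 1)" by (simp add: \<rho>_def)
  moreover have "\<rho> / (m - 1) \<le> \<eta> / 32"
  proof -
    have "2 \<le> \<eta> / 32 * (m - 1)" using m1(2) \<eta> by (simp add: field_simps)
    then have "\<rho> \<le> \<eta> / 32 * (m - 1)" using \<rho>(2) by linarith
    then show ?thesis using m1 by (simp add: pos_divide_le_eq)
  qed
  moreover have "\<delta> * (r - 1) \<ge> \<delta> * (1 / 4)" using r54 \<eta> by (intro mult_left_mono) (auto simp: \<delta>_def)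
  \<comment> \<open>The gain is at least \<open>\<eta> / 8\<close> and the error at most
    \<open>\<eta> / 32\<close>.\<close>
  ultimately have "q' \<ge> r * (m - 1) + \<eta> / 16" using \<eta> unfolding \<delta>_def by linarith
  then have "q' / (m - 1) \<ge> (r * (m - 1) + \<eta> / 16) / (m - 1)" using m1 by (intro divide_right_mono) auto
  then have "q' / (m - 1) \<ge> r + (\<eta> / 16) / (m - 1)" using m1 by (simp add: add_divide_distrib)
  moreover have "real (card (W - {u})) = m - 1"
    using u gr m1 by (simp add: m_def graph_on_def of_nat_diff)
  ultimately show thesis using that[OF u] by (simp add: q'_def r_def m_def)
qed

section \<open>Multipartite graphs\<close>

text \<open>Convexity of \<open>1 / y\<close> outside the open interval between \<open>y0\<close>
  and \<open>y1\<close>: the gap to the secant is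
  \<open>(y - y0) * (y - y1) / (y * y0 * y1)\<close>. For \<open>y0 = y1\<close> the secant becomes
  the tangent.\<close>

lemma inverse_ge_secant:
  fixes y y0 y1 :: real
  assumes "y > 0" "y0 > 0" "y1 > 0" "(y - y0) * (y - y1) \<ge> 0"
  shows "1 / y \<ge> 1 / y0 + 1 / y1 - y / (y0 * y1)"
    and "1 / y = 1 / y0 + 1 / y1 - y / (y0 * y1) \<longleftrightarrow> y = y0 \<or> y = y1"
proof -
  have *: "1 / y - (1 / y0 + 1 / y1 - y / (y0 * y1)) = (y - y0) * (y - y1) / (y * y0 * y1)"
    using assms by (simp add: field_simps)
  moreover have "(y - y0) * (y - y1) / (y * y0 * y1) \<ge> 0" using assms by (intro divide_nonneg_pos) auto
  ultimately show "1 / y \<ge> 1 / y0 + 1 / y1 - y / (y0 * y1)" by linarith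
  have "1 / y = 1 / y0 + 1 / y1 - y / (y0 * y1) \<longleftrightarrow> (y - y0) * (y - y1) / (y * y0 * y1) = 0"
    using * by linarith
  then show "1 / y = 1 / y0 + 1 / y1 - y / (y0 * y1) \<longleftrightarrow> y = y0 \<or> y = y1" using assms by auto
qed

text \<open>Turns secant bounds for \<open>1 / y\<close> into bounds for the map from
  \<open>s\<close> to \<open>s / (a + 2 * s)\<close>, concave for \<open>a > 0\<close>.\<close>

lemma multipartite_fraction:
  fixes a s :: real
  assumes "a + 2 * s > 0"
  shows "s / (a + 2 * s) = 1 / 2 - a / 2 * (1 / (a + 2 * s))"
  using assms by (simp add: field_simps)

text \<open>A vertex of part \<open>i\<close> has degree at most \<open>m - c i\<close>, so its
  eigenvalue equation gives \<open>(a + c i) * x u \<le> T - S i\<close>. Summing over the part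
  yields \<open>S i \<le> T * c i / (a + 2 * c i)\<close>, and summing over the parts allows
  division by \<open>T\<close>. Complete multipartite graphs have equality throughout, and with all
  parts nonempty equality forces completeness.\<close>

lemma k_partite_perron:
  fixes k :: nat
  assumes gr: "graph_on W E" and ne: "W \<noteq> {}"
    and pk: "\<And>u. u \<in> W \<Longrightarrow> p u < k"
    and proper: "\<And>u w. u \<in> W \<Longrightarrow> w \<in> W \<Longrightarrow> E u w \<Longrightarrow> p u \<noteq> p w"
    and q: "q_max W E > real (card W)"
  defines "a \<equiv> q_max W E - real (card W)" and "c \<equiv> (\<lambda>i. real (card {u\<in>W. p u = i}))"
  shows "(\<Sum>i<k. c i / (a + 2 * c i)) \<ge> 1"
    and "(\<Sum>i<k. c i / (a + 2 * c i)) = 1 \<Longrightarrow> \<forall>i<k. c i > 0 \<Longrightarrow> k \<ge> 2 \<Longrightarrow> 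
      u \<in> W \<Longrightarrow> w \<in> W \<Longrightarrow> p u \<noteq> p w \<Longrightarrow> E u w"
    and "\<forall>u\<in>W. \<forall>w\<in>W. p u \<noteq> p w \<longrightarrow> E u w \<Longrightarrow> (\<Sum>i<k. c i / (a + 2 * c i)) = 1"
proof -
  define q where "q = q_max W E"
  define m where "m = real (card W)"
  have fin: "finite W" using gr by (simp add: graph_on_def)
  obtain x where x: "\<And>u. x u \<ge> 0" "(\<Sum>u\<in>W. (x u)\<^sup>2) = 1" 
    "sl_form W E x = q" "\<And>u. u \<in> W \<Longrightarrow> sl_op W E x u = q * x u"
    using perron_vector[OF gr ne] unfolding q_def by blast
  define P where "P = (\<lambda>i. {u\<in>W. p u = i})"
  define S where "S = (\<lambda>i. \<Sum>u\<in>P i. x u)"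
  define T where "T = (\<Sum>u\<in>W. x u)"
  have finP: "finite (P i)" for i using fin by (simp add: P_def)
  have c: "c i = real (card (P i))" for i by (simp add: c_def P_def)
  have a: "a > 0" "a = q - m" using q by (auto simp: a_def q_def m_def)
  have ac: "a + 2 * c i > 0" "c i \<ge> 0" for i using a by (auto simp: c intro: add_pos_nonneg)
  have S0: "S i \<ge> 0" for i unfolding S_def by (intro sum_nonneg x)
  have T: "T = (\<Sum>i<k. S i)"
    unfolding T_def S_def P_def using pk fin by (subst sum.group) auto
  have "T > 0"
  proof (rule ccontr)
    assume "\<not> T > 0"
    then have "T = 0" using sum_nonneg[of W x] x(1) by (simp add: T_def)
    then have "\<forall>u\<in>W. x u = 0" unfolding T_def using fin x(1) by (subst (asm) sum_nonneg_eq_0_iff) auto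
    then show False using x(2) by simp
  qed
  have nb: "nbrs W E u \<subseteq> W - P (p u)" if "u \<in> W" for u
    using proper[OF that] by (fastforce simp: nbrs_def P_def)
  have outside: "(\<Sum>v\<in>W - P i. x v) = T - S i" for i
    unfolding T_def S_def using fin by (subst sum_diff) (auto simp: P_def)
  have cardW: "real (card (W - P i)) = m - c i" for i
    using fin finP card_mono[OF fin, of "P i"] by (subst card_Diff_subset) (auto simp: m_def c P_def of_nat_diff)
  have eig: "(q - real (card (nbrs W E u))) * x u = (\<Sum>v\<in>nbrs W E u. x v)" if "u \<in> W" for u
    using x(4)[OF that] by (simp add: sl_op_eq algebra_simps)
  have deg: "real (card (nbrs W E u)) \<le> m - c (p u)" if "u \<in> W" for u
    using nb[OF that] fin by (subst cardW[symmetric]) (simp add: card_mono)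
  have bound: "(a + c (p u)) * x u \<le> T - S (p u)" if "u \<in> W" for u
  proof -
    have "(a + c (p u)) * x u \<le> (q - real (card (nbrs W E u))) * x u"
      using deg[OF that] x(1) a by (intro mult_right_mono) auto
    also have "\<dots> \<le> T - S (p u)"
      unfolding eig[OF that] outside[symmetric] using nb[OF that] fin x(1) by (intro sum_mono2) auto
    finally show ?thesis .
  qed
  have SU: "(a + c i) * S i = (\<Sum>u\<in>P i. (a + c i) * x u)" "c i * (T - S i) = (\<Sum>u\<in>P i. T - S i)" for i
    by (simp_all add: S_def sum_distrib_left c)
  have "(a + c i) * S i \<le> c i * (T - S i)" for i
    unfolding SU using bound by (intro sum_mono) (auto simp: P_def)
  then have Sle: "S i \<le> T * (c i / (a + 2 * c i))" for i
    using ac[of i] by (simp add: field_simps)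
  have "T * 1 \<le> T * (\<Sum>i<k. c i / (a + 2 * c i))"
    unfolding sum_distrib_left using T Sle by (simp add: sum_mono)
  then show "(\<Sum>i<k. c i / (a + 2 * c i)) \<ge> 1" using \<open>T > 0\<close> by simp
  {
    assume "\<forall>u\<in>W. \<forall>w\<in>W. p u \<noteq> p w \<longrightarrow> E u w"
    then have nbeq: "nbrs W E u = W - P (p u)" if "u \<in> W" for u
      using nb[OF that] that by (auto simp: nbrs_def P_def)
    have "(a + c (p u)) * x u = T - S (p u)" if "u \<in> W" for u
      using eig[OF that] unfolding nbeq[OF that] outside cardW a(2) by (simp add: algebra_simps)
    then have "(a + c i) * S i = c i * (T - S i)" for i
      unfolding SU by (intro sum.cong) (auto simp: P_def)
    then have ST: "S i = T * (c i / (a + 2 * c i))" for i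
      using ac[of i] by (simp add: field_simps)
    have "T * 1 = (\<Sum>i<k. S i)" using T by simp
    also have "\<dots> = T * (\<Sum>i<k. c i / (a + 2 * c i))"
      unfolding sum_distrib_left by (intro sum.cong refl ST)
    finally show "(\<Sum>i<k. c i / (a + 2 * c i)) = 1" using \<open>T > 0\<close> by simp
  }
  assume sum1: "(\<Sum>i<k. c i / (a + 2 * c i)) = 1" and cpos: "\<forall>i<k. c i > 0" and k: "k \<ge> 2"
    and u: "u \<in> W" and w: "w \<in> W" and puw: "p u \<noteq> p w"
  have "(\<Sum>i<k. T * (c i / (a + 2 * c i)) - S i) = 0"
    unfolding sum_subtractf sum_distrib_left[symmetric] sum1 T[symmetric] by simp
  \<comment> \<open>The nonnegative slacks sum to 0, so each part attains its bound; the same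
    argument inside part \<open>i\<close> then gives equality at \<open>u\<close> itself.\<close>
  then have Seq: "S i = T * (c i / (a + 2 * c i))" if "i < k" for i
    using that Sle by (subst (asm) sum_nonneg_eq_0_iff) auto
  have Spos: "S i > 0" if "i < k" for i
    using Seq[OF that] cpos that \<open>T > 0\<close> ac(1)[of i] by simp
  define i where "i = p u"
  have i: "i < k" "p w < k" using pk u w by (auto simp: i_def)
  have "(\<Sum>j\<in>{i, p w}. S j) \<le> T"
    unfolding T using i S0 by (intro sum_mono2) auto
  then have TS: "T - S i > 0" using Spos[OF i(2)] puw by (simp add: i_def)
  have "(a + c i) * S i = c i * (T - S i)"
    using Seq[OF i(1)] ac(1)[of i] by (simp add: field_simps)
  moreover have "(\<Sum>u\<in>P i. (T - S i) - (a + c i) * x u) = c i * (T - S i) - (a + c i) * S i"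
    unfolding SU by (simp only: sum_subtractf)
  ultimately have "(\<Sum>u\<in>P i. (T - S i) - (a + c i) * x u) = 0" by simp
  moreover have "(T - S i) - (a + c i) * x v \<ge> 0" if "v \<in> P i" for v
    using bound[of v] that by (simp add: P_def)
  ultimately have xu: "(a + c i) * x u = T - S i"
    using finP u by (subst (asm) sum_nonneg_eq_0_iff) (auto simp: P_def i_def)
  then have "x u \<noteq> 0" using TS by auto
  then have xpos: "x u > 0" using x(1)[of u] by linarith
  have "(q - real (card (nbrs W E u))) * x u \<le> T - S i"
    unfolding eig[OF u] outside[symmetric] using nb[OF u] fin x(1) by (intro sum_mono2) (auto simp: i_def)
  then have "(q - real (card (nbrs W E u))) * x u \<le> (a + c i) * x u" using xu by simp
  \<comment> \<open>Positivity of \<open>x u\<close> lets the degree be read off: \<open>u\<close>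
    has at least as many neighbours as there are vertices outside its part.\<close>
  then have "q - real (card (nbrs W E u)) \<le> a + c i" using xpos by simp
  then have "real (card (nbrs W E u)) \<ge> real (card (W - P i))" unfolding cardW a(2) by simp
  then have "nbrs W E u = W - P i"
    using nb[OF u] fin by (intro card_subset_eq) (auto simp: i_def dest: card_mono[rotated] intro: antisym card_mono)
  then have "w \<in> nbrs W E u" using w puw by (auto simp: P_def i_def)
  then show "E u w" by (simp add: nbrs_def)
qed

lemma sum_card_parts:
  assumes "finite W" "\<And>u. u \<in> W \<Longrightarrow> p u < (k::nat)"
  shows "(\<Sum>i<k. real (card {u\<in>W. p u = i})) = real (card W)"
proof -
  have "(\<Sum>i<k. \<Sum>u\<in>{u\<in>W. p u = i}. 1 :: real) = (\<Sum>u\<in>W. 1)"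
    using assms by (intro sum.group) auto
  then show ?thesis by simp
qed

text \<open>By concavity, replacing every part size by the mean \<open>m / k\<close> can only
  increase the sum from \<open>k_partite_perron\<close>. The resulting inequality
  \<open>m / (a + 2 * m / k) \<ge> 1\<close> is the claim.\<close>

lemma k_partite_q_max_le:
  assumes gr: "graph_on W E" and ne: "W \<noteq> {}" and k: "k \<ge> 2"
    and pk: "\<And>u. u \<in> W \<Longrightarrow> p u < k"
    and proper: "\<And>u w. u \<in> W \<Longrightarrow> w \<in> W \<Longrightarrow> E u w \<Longrightarrow> p u \<noteq> p w"
  shows "q_max W E \<le> (2 - 2 / real k) * real (card W)"
proof (cases "q_max W E > real (card W)")
  case False
  have "1 * real (card W) \<le> (2 - 2 / real k) * real (card W)"
    using k by (intro mult_right_mono) (auto simp: field_simps)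
  then show ?thesis using False by linarith
next
  case True
  define a where "a = q_max W E - real (card W)"
  define c where "c = (\<lambda>i. real (card {u\<in>W. p u = i}))"
  define m where "m = real (card W)"
  \<comment> \<open>The value of \<open>a + 2 * s\<close> at the mean part size, where the tangent
    is taken.\<close>
  define y where "y = a + 2 * m / real k"
  have a: "a > 0" using True by (simp add: a_def)
  have y: "y > 0" using a by (auto simp: y_def m_def intro: add_pos_nonneg)
  have fin: "finite W" using gr by (simp add: graph_on_def)
  have sumc: "(\<Sum>i<k. c i) = m" unfolding c_def m_def using fin pk by (rule sum_card_parts)
  have "1 \<le> (\<Sum>i<k. c i / (a + 2 * c i))"
    using k_partite_perron(1)[OF gr ne pk proper True] by (simp add: a_def c_def)
  also have "\<dots> \<le> (\<Sum>i<k. 1 / 2 - a / 2 * (1 / y + 1 / y - (a + 2 * c i) / (y * y)))"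
  proof (intro sum_mono)
    fix i
    have ac: "a + 2 * c i > 0" using a by (auto simp: c_def intro: add_pos_nonneg)
    have "1 / (a + 2 * c i) \<ge> 1 / y + 1 / y - (a + 2 * c i) / (y * y)"
      using ac y by (intro inverse_ge_secant(1)) auto
    then show "c i / (a + 2 * c i) \<le> 1 / 2 - a / 2 * (1 / y + 1 / y - (a + 2 * c i) / (y * y))"
      unfolding multipartite_fraction[OF ac] using a by (intro diff_left_mono mult_left_mono) auto
  qed
  also have "\<dots> = real k / 2 - a / 2 * (real k * (2 / y) - (real k * a + 2 * m) / (y * y))"
    by (simp add: sum_subtractf sum.distrib sum_distrib_left[symmetric] sum_divide_distrib[symmetric] sumc)
  also have "real k * a + 2 * m = real k * y" using k by (simp add: y_def field_simps)
  also have "real k / 2 - a / 2 * (real k * (2 / y) - (real k * y) / (y * y)) = real k / 2 - a / 2 * (real k / y)"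
    using y by (simp add: field_simps)
  finally have "2 * y \<le> real k * y - a * real k" using y by (simp add: field_simps)
  also have "\<dots> = 2 * m" using k by (simp add: y_def field_simps)
  finally have "a + 2 * m / real k \<le> m" by (simp add: y_def)
  then show ?thesis by (simp add: a_def m_def algebra_simps)
qed

section \<open>Part sizes and index of the Turan graph\<close>

lemma card_turan_part:
  assumes "i < k"
  shows "n div k \<le> card {u\<in>{..<n}. u mod k = i}" "card {u\<in>{..<n}. u mod k = i} \<le> n div k + 1"
proof -
  have inj: "inj_on (\<lambda>j. j * k + i) A" for A using assms by (intro inj_onI) auto
  have "(\<lambda>j. j * k + i) ` {..<n div k} \<subseteq> {u\<in>{..<n}. u mod k = i}"
  proof clarsimp
    fix j assume j: "j < n div k"
    then have "(j + 1) * k \<le> n div k * k" by (intro mult_right_mono) auto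
    also have "\<dots> \<le> n" by simp
    finally show "j * k + i < n \<and> i mod k = i" using assms by simp
  qed
  then have "card ((\<lambda>j. j * k + i) ` {..<n div k}) \<le> card {u\<in>{..<n}. u mod k = i}"
    by (rule card_mono[rotated]) auto
  then show "n div k \<le> card {u\<in>{..<n}. u mod k = i}" by (simp add: card_image[OF inj])
  have "{u\<in>{..<n}. u mod k = i} \<subseteq> (\<lambda>j. j * k + i) ` {..n div k}"
  proof
    fix u assume "u \<in> {u\<in>{..<n}. u mod k = i}"
    then have "u = (u div k) * k + i" "u div k \<le> n div k" by (auto simp: div_le_mono)
    then show "u \<in> (\<lambda>j. j * k + i) ` {..n div k}" by blast
  qed
  then have "card {u\<in>{..<n}. u mod k = i} \<le> card ((\<lambda>j. j * k + i) ` {..n div k})"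
    by (rule card_mono[rotated]) auto
  then show "card {u\<in>{..<n}. u mod k = i} \<le> n div k + 1" by (simp add: card_image[OF inj])
qed

lemma simple_graph_turan: "simple_graph n (turan k)"
  by (auto simp: simple_graph_def turan_def)

lemma graph_on_simple_graph: "graph_on {..<n} E \<longleftrightarrow> simple_graph n E"
  by (auto simp: graph_on_def simple_graph_def)

text \<open>The constant test vector gives twice the average degree. Part sizes are within 1 of
  \<open>n / k\<close>, so their squares sum to at most \<open>n\<^sup>2 / k + k\<close>.\<close>

lemma q_max_turan_ge:
  assumes k: "k > 0" and n: "n > 0"
  shows "q_max {..<n} (turan k) \<ge> (2 - 2 / real k) * real n - 2 * real k / real n"
proof -
  have gr: "graph_on {..<n} (turan k)" by (simp add: graph_on_simple_graph simple_graph_turan)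
  define t where "t = (\<lambda>i. real (card {u\<in>{..<n}. u mod k = i}))"
  define \<mu> where "\<mu> = real n / real k"
  have \<mu>: "real (n div k) \<le> \<mu>" "\<mu> \<le> real (n div k) + 1"
  proof -
    have "n div k * k \<le> n" "n \<le> (n div k + 1) * k"
      using k dividend_less_times_div[of k n] by (simp_all add: algebra_simps less_imp_le)
    then have "real (n div k) * real k \<le> real n" "real n \<le> (real (n div k) + 1) * real k"
      by (metis of_nat_le_iff of_nat_mult) (metis \<open>n \<le> (n div k + 1) * k\<close> of_nat_1 of_nat_add of_nat_le_iff of_nat_mult)
    then show "real (n div k) \<le> \<mu>" "\<mu> \<le> real (n div k) + 1"
      using k by (simp_all add: \<mu>_def field_simps)
  qed
  have tsum: "(\<Sum>i<k. t i) = real n"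
    unfolding t_def using k sum_card_parts[of "{..<n}" "\<lambda>u. u mod k" k] by simp
  have "(\<Sum>i<k. (t i - \<mu>)\<^sup>2) \<le> (\<Sum>i<k. 1)"
  proof (intro sum_mono)
    fix i assume "i \<in> {..<k}"
    then have "\<bar>t i - \<mu>\<bar> \<le> 1" using card_turan_part[of i k n] \<mu> by (auto simp: t_def abs_le_iff)
    then show "(t i - \<mu>)\<^sup>2 \<le> 1" by (simp add: abs_square_le_1)
  qed
  moreover have "(\<Sum>i<k. (t i - \<mu>)\<^sup>2) = (\<Sum>i<k. (t i)\<^sup>2 - 2 * \<mu> * t i + \<mu>\<^sup>2)"
    by (intro sum.cong refl) (simp add: power2_eq_square algebra_simps)
  moreover have "\<dots> = (\<Sum>i<k. (t i)\<^sup>2) - 2 * \<mu> * real n + real k * \<mu>\<^sup>2"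
    by (simp add: sum.distrib sum_subtractf sum_distrib_left[symmetric] tsum)
  moreover have "real k * \<mu>\<^sup>2 = \<mu> * real n" using k by (simp add: \<mu>_def power2_eq_square)
  ultimately have tsq: "(\<Sum>i<k. (t i)\<^sup>2) \<le> \<mu> * real n + real k" by simp
  have deg: "real (card (nbrs {..<n} (turan k) u)) = real n - t (u mod k)" for u
  proof -
    have "nbrs {..<n} (turan k) u = {..<n} - {w\<in>{..<n}. w mod k = u mod k}"
      by (auto simp: nbrs_def turan_def)
    moreover have "card ({..<n} - {w\<in>{..<n}. w mod k = u mod k}) = n - card {w\<in>{..<n}. w mod k = u mod k}"
      by (subst card_Diff_subset) auto
    moreover have "card {w\<in>{..<n}. w mod k = u mod k} \<le> card {..<n}" by (intro card_mono) auto
    ultimately have "card (nbrs {..<n} (turan k) u) + card {w\<in>{..<n}. w mod k = u mod k} = n"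
      by simp
    then show ?thesis by (simp add: t_def)
  qed
  have "(\<Sum>u<n. t (u mod k)) = (\<Sum>i<k. \<Sum>u\<in>{u\<in>{..<n}. u mod k = i}. t (u mod k))"
    using k by (intro sum.group[symmetric]) auto
  also have "\<dots> = (\<Sum>i<k. (t i)\<^sup>2)"
    by (intro sum.cong refl) (simp add: t_def power2_eq_square)
  finally have "sl_form {..<n} (turan k) (\<lambda>_. 1) = 2 * (real n * real n - (\<Sum>i<k. (t i)\<^sup>2))"
    by (simp add: sl_form_def deg sum_subtractf flip: sum_distrib_right)
  also have "\<dots> \<ge> 2 * (real n * real n - (\<mu> * real n + real k))" using tsq by simp
  finally have "2 * (real n * real n - (\<mu> * real n + real k)) \<le> q_max {..<n} (turan k) * real n"
    using sl_form_le_q_max[OF gr, of "\<lambda>_. 1"] by simp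
  moreover have "2 * (real n * real n - (\<mu> * real n + real k)) = ((2 - 2 / real k) * real n - 2 * real k / real n) * real n"
    using k n by (simp add: \<mu>_def field_simps)
  ultimately show ?thesis using n by simp
qed

section \<open>Recognising the Turan graph among \<open>k\<close>-partite graphs\<close>

text \<open>Equal sums of values \<open>f\<close> and \<open>f + 1\<close> mean equally many of
  each; bijections of the two level sets are glued.\<close>

lemma balanced_parts_permutation:
  fixes c t :: "nat \<Rightarrow> nat"
  assumes c: "\<And>i. i < k \<Longrightarrow> c i = f \<or> c i = f + 1" and t: "\<And>i. i < k \<Longrightarrow> t i = f \<or> t i = f + 1"
    and sum: "(\<Sum>i<k. c i) = (\<Sum>i<k. t i)"
  obtains \<sigma> where "bij_betw \<sigma> {..<k} {..<k}" "\<And>i. i < k \<Longrightarrow> t (\<sigma> i) = c i"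
proof -
  define H where "H = (\<lambda>g :: nat \<Rightarrow> nat. {i\<in>{..<k}. g i = f + 1})"
  have cardH: "(\<Sum>i<k. g i) = k * f + card (H g)" if "\<And>i. i < k \<Longrightarrow> g i = f \<or> g i = f + 1" for g
  proof -
    have "(\<Sum>i<k. g i) = (\<Sum>i<k. f + (if g i = f + 1 then 1 else 0))"
      using that by (intro sum.cong) auto
    also have "\<dots> = k * f + card (H g)" by (simp add: sum.distrib H_def sum.If_cases Int_def)
    finally show ?thesis .
  qed
  have eq: "card (H c) = card (H t)" using cardH[OF c] cardH[OF t] sum by simp
  have sub: "H g \<subseteq> {..<k}" "finite (H g)" for g by (auto simp: H_def)
  have "card ({..<k} - H c) = card ({..<k} - H t)" using eq sub by (simp add: card_Diff_subset)
  then obtain h1 h2 where h: "bij_betw h1 (H c) (H t)" "bij_betw h2 ({..<k} - H c) ({..<k} - H t)"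
    using finite_same_card_bij[OF sub(2) sub(2) eq] finite_same_card_bij[of "{..<k} - H c" "{..<k} - H t"] by auto
  define \<sigma> where "\<sigma> = (\<lambda>i. if i \<in> H c then h1 i else h2 i)"
  have b1: "bij_betw \<sigma> (H c) (H t)" using h(1) by (rule bij_betw_cong[THEN iffD1, rotated]) (simp add: \<sigma>_def)
  have b2: "bij_betw \<sigma> ({..<k} - H c) ({..<k} - H t)"
    using h(2) by (rule bij_betw_cong[THEN iffD1, rotated]) (simp add: \<sigma>_def)
  have "bij_betw \<sigma> (H c \<union> ({..<k} - H c)) (H t \<union> ({..<k} - H t))"
    using b1 b2 by (rule bij_betw_combine) auto
  moreover have "H g \<union> ({..<k} - H g) = {..<k}" for g using sub(1) by blast
  ultimately have "bij_betw \<sigma> {..<k} {..<k}" by simp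
  moreover have "t (\<sigma> i) = c i" if i: "i < k" for i
  proof (cases "i \<in> H c")
    case True
    then have "\<sigma> i \<in> H t" using b1 by (auto simp: bij_betw_def)
    then show ?thesis using True by (simp add: H_def)
  next
    case False
    then have "\<sigma> i \<in> {..<k} - H t" using b2 i by (auto simp: bij_betw_def)
    then show ?thesis using False i c[of i] t[of "\<sigma> i"] by (auto simp: H_def)
  qed
  ultimately show thesis by (rule that)
qed

lemma complete_multipartite_iso:
  assumes p: "\<And>u. u < n \<Longrightarrow> p u < k" and E: "\<And>u w. u < n \<Longrightarrow> w < n \<Longrightarrow> E u w \<longleftrightarrow> p u \<noteq> p w"
    and F: "\<And>u w. u < n \<Longrightarrow> w < n \<Longrightarrow> F u w \<longleftrightarrow> r u \<noteq> r w"
    and \<sigma>: "inj_on \<sigma> {..<k}" 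
    and parts: "\<And>i. i < k \<Longrightarrow> card {u\<in>{..<n}. p u = i} = card {u\<in>{..<n}. r u = \<sigma> i}"
  shows "graph_iso n E F"
proof -
  have "\<exists>g. bij_betw g {u\<in>{..<n}. p u = i} {u\<in>{..<n}. r u = \<sigma> i}" if "i < k" for i
    by (intro finite_same_card_bij parts that) auto
  then obtain g where g: "\<And>i. i < k \<Longrightarrow> bij_betw (g i) {u\<in>{..<n}. p u = i} {u\<in>{..<n}. r u = \<sigma> i}"
    by metis
  define h where "h = (\<lambda>u. g (p u) u)"
  have h: "h u < n" "r (h u) = \<sigma> (p u)" if "u < n" for u
    using bij_betwE[OF g[OF p[OF that]]] that by (auto simp: h_def)
  have part: "r (h u) = r (h w) \<longleftrightarrow> p u = p w" if "u < n" "w < n" for u w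
    using h(2)[OF that(1)] h(2)[OF that(2)] \<sigma> p that by (auto simp: inj_on_def)
  have "inj_on h {..<n}"
  proof (rule inj_onI)
    fix u w assume uw: "u \<in> {..<n}" "w \<in> {..<n}" "h u = h w"
    then have eq: "p u = p w" using part[of u w] by auto
    have "inj_on (g (p u)) {v\<in>{..<n}. p v = p u}" using g[of "p u"] p uw by (auto simp: bij_betw_def)
    then show "u = w" using uw eq by (auto simp: inj_on_def h_def)
  qed
  moreover have "h ` {..<n} \<subseteq> {..<n}" using h(1) by auto
  ultimately have "bij_betw h {..<n} {..<n}" by (simp add: bij_betw_def endo_inj_surj)
  then show ?thesis unfolding graph_iso_def
    using E F part h(1) by (intro exI[of _ h]) auto
qed

text \<open>The Turan graph attains the sum 1 with part sizes \<open>f\<close> and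
  \<open>f + 1\<close>. Integers avoid the open interval between these, so the secant
  \<open>L\<close> dominates \<open>s / (b + 2 * s)\<close> at all possible part sizes. As
  \<open>L\<close> is affine, its sum depends only on the total \<open>n\<close>, which squeezes the
  sum for \<open>E\<close> between 1 and 1.\<close>

lemma turan_extremal_k_partite:
  assumes k: "k \<ge> 2" and n: "n \<ge> k" and G: "simple_graph n E"
    and pk: "\<And>u. u < n \<Longrightarrow> p u < k"
    and proper: "\<And>u w. u < n \<Longrightarrow> w < n \<Longrightarrow> E u w \<Longrightarrow> p u \<noteq> p w"
    and qT: "q_max {..<n} (turan k) > real n"
    and q: "q_max {..<n} E \<ge> q_max {..<n} (turan k)"
  shows "graph_iso n E (turan k)"
proof -
  have grE: "graph_on {..<n} E" and grT: "graph_on {..<n} (turan k)"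
    using G by (simp_all add: graph_on_simple_graph simple_graph_turan)
  have ne: "{..<n} \<noteq> {}" using n k by (simp add: lessThan_empty_iff)
  define a where "a = q_max {..<n} E - real n"
  define b where "b = q_max {..<n} (turan k) - real n"
  define c where "c = (\<lambda>i. card {u\<in>{..<n}. p u = i})"
  define t where "t = (\<lambda>i. card {u\<in>{..<n}. u mod k = i})"
  define f where "f = n div k"
  define y0 where "y0 = b + 2 * real f"
  define y1 where "y1 = b + 2 * real (f + 1)"
  define L where "L = (\<lambda>s :: real. 1 / 2 - b / 2 * (1 / y0 + 1 / y1 - (b + 2 * s) / (y0 * y1)))"
  have b: "b > 0" "a \<ge> b" using qT q by (auto simp: a_def b_def)
  have y: "y0 > 0" "y1 > 0" using b by (auto simp: y0_def y1_def)
  \<comment> \<open>Makes all parts nonempty once their sizes are known to be \<open>f\<close> or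
    \<open>f + 1\<close>.\<close>
  have f: "f \<ge> 1" using n k by (auto simp: f_def div_greater_zero_iff Suc_le_eq)
  have cn: "(\<Sum>i<k. real (c i)) = real n"
    unfolding c_def using sum_card_parts[of "{..<n}" p k] pk by simp
  have tn: "(\<Sum>i<k. real (t i)) = real n"
    unfolding t_def using sum_card_parts[of "{..<n}" "\<lambda>u. u mod k" k] k by simp
  have t: "t i = f \<or> t i = f + 1" if "i < k" for i
    using card_turan_part[OF that, of n] by (auto simp: t_def f_def)
  have secant: "(b + 2 * real s - y0) * (b + 2 * real s - y1) \<ge> 0" for s :: nat
  proof (cases "s \<le> f")
    case True
    then show ?thesis by (intro mult_nonpos_nonpos) (auto simp: y0_def y1_def)
  next
    case False
    then show ?thesis by (intro mult_nonneg_nonneg) (auto simp: y0_def y1_def)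
  qed
  have pos: "b + 2 * real s > 0" for s :: nat using b by (simp add: add_pos_nonneg)
  have Lge: "real s / (b + 2 * real s) \<le> L (real s)" for s :: nat
    unfolding multipartite_fraction[OF pos] L_def
    using b inverse_ge_secant(1)[OF pos y secant] by (intro diff_left_mono mult_left_mono) auto
  have Leq: "real s / (b + 2 * real s) = L (real s) \<longleftrightarrow> s = f \<or> s = f + 1" for s :: nat
  proof -
    have "real s / (b + 2 * real s) = L (real s) \<longleftrightarrow>
        1 / (b + 2 * real s) = 1 / y0 + 1 / y1 - (b + 2 * real s) / (y0 * y1)"
    proof -
      have "1 / 2 - b / 2 * v = 1 / 2 - b / 2 * w \<longleftrightarrow> v = w" for v w using b by simp
      then show ?thesis unfolding multipartite_fraction[OF pos] L_def .
    qed
    also have "\<dots> \<longleftrightarrow> b + 2 * real s = y0 \<or> b + 2 * real s = y1"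
      by (rule inverse_ge_secant(2)[OF pos y secant])
    also have "\<dots> \<longleftrightarrow> s = f \<or> s = f + 1"
      unfolding y0_def y1_def by (simp del: of_nat_add of_nat_Suc)
    finally show ?thesis .
  qed
  have Lsum: "(\<Sum>i<k. L (g i)) = real k / 2 - b / 2 * (real k * (1 / y0 + 1 / y1) - (real k * b + 2 * real n) / (y0 * y1))"
    if "(\<Sum>i<k. g i) = real n" for g
    unfolding L_def
    by (simp add: sum_subtractf sum.distrib sum_distrib_left[symmetric] sum_divide_distrib[symmetric] that)
  have "(\<Sum>i<k. real (t i) / (b + 2 * real (t i))) = 1"
    unfolding t_def b_def
    using k_partite_perron(3)[OF grT ne, of "\<lambda>u. u mod k" k] k qT by (simp add: turan_def)
  moreover have "(\<Sum>i<k. real (t i) / (b + 2 * real (t i))) = (\<Sum>i<k. L (real (t i)))"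
    using t Leq by (intro sum.cong) auto
  ultimately have Lc: "(\<Sum>i<k. L (real (c i))) = 1" using Lsum[OF cn] Lsum[OF tn] by simp
  have qn: "real (card {..<n}) < q_max {..<n} E" using qT q by simp
  have perron: "(\<Sum>i<k. real (c i) / (a + 2 * real (c i))) \<ge> 1"
    unfolding c_def a_def using k_partite_perron(1)[OF grE ne _ _ qn, of p k] pk proper by simp
  have ab: "real (c i) / (a + 2 * real (c i)) \<le> real (c i) / (b + 2 * real (c i))" for i
    using b pos[of "c i"] by (intro divide_left_mono) auto
  have "(\<Sum>i<k. real (c i) / (a + 2 * real (c i))) \<le> (\<Sum>i<k. real (c i) / (b + 2 * real (c i)))"
    using ab by (intro sum_mono)
  moreover have "(\<Sum>i<k. real (c i) / (b + 2 * real (c i))) \<le> (\<Sum>i<k. L (real (c i)))"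
    using Lge by (intro sum_mono)
  \<comment> \<open>The first equality yields completeness between the parts, the second yields
    balanced part sizes.\<close>
  ultimately have eqs: "(\<Sum>i<k. real (c i) / (a + 2 * real (c i))) = 1" "(\<Sum>i<k. L (real (c i)) - real (c i) / (b + 2 * real (c i))) = 0"
    using perron Lc by (auto simp: sum_subtractf)
  have "\<forall>i\<in>{..<k}. L (real (c i)) - real (c i) / (b + 2 * real (c i)) = 0"
    using eqs(2) Lge by (subst (asm) sum_nonneg_eq_0_iff) auto
  then have "L (real (c i)) = real (c i) / (b + 2 * real (c i))" if "i < k" for i
    using that by simp
  then have c: "c i = f \<or> c i = f + 1" if "i < k" for i
    using Leq[of "c i"] that by simp
  have cpos: "\<forall>i<k. 0 < real (c i)" using c f by force
  have complete: "E u w" if "u < n" "w < n" "p u \<noteq> p w" for u w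
    using k_partite_perron(2)[OF grE ne _ _ qn, of p k u w] pk proper eqs(1) cpos k that
    unfolding c_def a_def by simp
  have "(\<Sum>i<k. c i) = (\<Sum>i<k. t i)" using cn tn by (simp flip: of_nat_sum)
  then obtain \<sigma> where \<sigma>: "bij_betw \<sigma> {..<k} {..<k}" "\<And>i. i < k \<Longrightarrow> t (\<sigma> i) = c i"
    using balanced_parts_permutation[of k c f t] c t by blast
  show ?thesis
  proof (rule complete_multipartite_iso[where p = p and r = "\<lambda>u. u mod k" and \<sigma> = \<sigma> and k = k])
    show "inj_on \<sigma> {..<k}" using \<sigma>(1) by (simp add: bij_betw_def)
    show "E u w \<longleftrightarrow> p u \<noteq> p w" if "u < n" "w < n" for u w using complete proper that by blast
  qed (use pk \<sigma>(2) in \<open>auto simp: turan_def c_def t_def\<close>)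
qed

section \<open>Graphs with at least the index of the Turan graph\<close>

text \<open>Among the subgraphs reached by deletions, take a smallest one: the quotient \<open>q / |W|\<close> grew by
  \<open>\<beta> * ln (n / |W|)\<close> but is at most 2, so linearly many vertices survive.\<close>

lemma q_max_descent:
  fixes k :: nat and \<eta> \<beta> \<gamma> :: real
  defines "\<beta> \<equiv> \<eta> / 16" and "\<gamma> \<equiv> exp (- (16 / \<eta>))"
  assumes gr: "graph_on V E" and ne: "V \<noteq> {}" and \<eta>: "0 < \<eta>" "\<eta> \<le> 1 / 12" and k: "k \<ge> 3"
    and q: "q_max V E \<ge> (2 - 2 / real k - \<eta>) * real (card V)"
    and n: "\<gamma> * real (card V) \<ge> 1 + 64 / \<eta>"
  obtains W where "W \<subseteq> V" "W \<noteq> {}" "real (card W) \<ge> \<gamma> * real (card V)"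
    "q_max W E / real (card W) + \<beta> * ln (real (card W)) \<ge> q_max V E / real (card V) + \<beta> * ln (real (card V))"
    "\<And>v. v \<in> W \<Longrightarrow> real (card (nbrs W E v)) > (1 - 1 / real k - \<eta>) * real (card W)"
proof -
  \<comment> \<open>The invariant of the deletion process; a smallest set satisfying it replaces the
    iteration.\<close>
  define F where "F = (\<lambda>W. W \<subseteq> V \<and> W \<noteq> {} \<and> real (card W) \<ge> \<gamma> * real (card V) \<and>
    q_max W E / real (card W) + \<beta> * ln (real (card W)) \<ge> q_max V E / real (card V) + \<beta> * ln (real (card V)))"
  have \<beta>: "\<beta> > 0" using \<eta> by (simp add: \<beta>_def)
  have fin: "finite V" using gr by (simp add: graph_on_def)
  have cV: "real (card V) > 0" using ne fin by (simp add: card_gt_0_iff)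
  have k3: "2 / real k \<le> 2 / 3" using k by (simp add: field_simps)
  have "F V" using ne by (auto simp: F_def \<gamma>_def \<eta>(1) less_imp_le mult_left_le_one_le)
  then obtain W where W: "F W" and least: "\<And>U. F U \<Longrightarrow> card W \<le> card U"
    using ex_has_least_nat[of F V card] by blast
  have WV: "W \<subseteq> V" "W \<noteq> {}" using W by (auto simp: F_def)
  have grW: "graph_on W E" using gr WV(1) by (rule graph_on_subset)
  define m where "m = real (card W)"
  have m: "m \<ge> \<gamma> * real (card V)" using W by (simp add: F_def m_def)
  have "64 / \<eta> > 0" using \<eta> by simp
  then have m1: "m > 1" "m \<ge> 1 + 64 / \<eta>" using m n by linarith+
  have q0: "q_max V E / real (card V) \<ge> 2 - 2 / real k - \<eta>" using q cV by (simp add: field_simps)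
  have mV: "m \<le> real (card V)" using card_mono[OF fin WV(1)] by (simp add: m_def)
  have Wge: "q_max W E / m + \<beta> * ln m \<ge> q_max V E / real (card V) + \<beta> * ln (real (card V))"
    using W by (simp add: F_def m_def)
  \<comment> \<open>Since the logarithm has not grown, the ratio has not dropped, and the deletion
    lemma still applies to \<open>W\<close>.\<close>
  moreover have "\<beta> * ln m \<le> \<beta> * ln (real (card V))" using mV m1 \<beta> by (intro mult_left_mono) auto
  ultimately have "q_max W E / m \<ge> 2 - 2 / real k - \<eta>" using q0 by linarith
  then have qW: "q_max W E \<ge> (2 - 2 / real k - \<eta>) * real (card W)" using m1 by (simp add: m_def field_simps)
  have "real (card (nbrs W E v)) > (1 - 1 / real k - \<eta>) * real (card W)" if v: "v \<in> W" for v
  proof (rule ccontr)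
    assume "\<not> ?thesis"
    then have low: "real (card (nbrs W E v)) \<le> (1 - 1 / real k - \<eta>) * real (card W)" by simp
    obtain u where u: "u \<in> W" and
      grow: "q_max (W - {u}) E / real (card (W - {u})) \<ge> q_max W E / real (card W) + (\<eta> / 16) / real (card (W - {u}))"
      using q_max_delete_low_degree[OF grW v \<eta> k low qW] m1(2) unfolding m_def by blast
    define U where "U = W - {u}"
    define m' where "m' = real (card U)"
    have finW: "finite W" using WV(1) fin by (rule finite_subset)
    have m': "m' = m - 1" using u finW m1 by (simp add: m'_def m_def U_def of_nat_diff)
    have "m' > 0" using m' m1 by simp
    then have U: "U \<subseteq> V" "U \<noteq> {}" "m' > 0" using WV(1) by (auto simp: U_def m'_def card_gt_0_iff)
    have grU: "graph_on U E" using gr U(1) by (rule graph_on_subset)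
    \<comment> \<open>One deletion costs at most \<open>\<beta> / m'\<close> in the logarithm, which
      the growth of the ratio pays for.\<close>
    have "ln m - ln m' = ln (m / m')" using m1 m' by (simp add: ln_div)
    also have "\<dots> \<le> m / m' - 1" using m1 m' by (intro ln_le_minus_one) auto
    also have "\<dots> = 1 / m'" using U(3) m' by (simp add: field_simps)
    finally have "\<beta> * (ln m - ln m') \<le> \<beta> * (1 / m')" using \<beta> by (intro mult_left_mono) auto
    moreover have "q_max U E / m' \<ge> q_max W E / m + \<beta> / m'" using grow by (simp add: U_def m'_def m_def \<beta>_def)
    ultimately have Uge: "q_max U E / m' + \<beta> * ln m' \<ge> q_max V E / real (card V) + \<beta> * ln (real (card V))"
      using Wge by (simp add: algebra_simps)
    show False
    proof (cases "m' \<ge> \<gamma> * real (card V)")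
      case True
      then have "F U" using U Uge by (simp add: F_def m'_def)
      then have "card W \<le> card U" by (rule least)
      then show False using m' by (simp add: m_def m'_def)
    next
      case False
      \<comment> \<open>Below \<open>\<gamma> * card V\<close> vertices the logarithmic term has
        lost at least \<open>\<beta> * 16 / \<eta> = 1\<close>, so the ratio would exceed 2.\<close>
      then have "ln m' \<le> ln (\<gamma> * real (card V))" using U(3) by simp
      also have "\<dots> = - (16 / \<eta>) + ln (real (card V))" using cV by (simp add: ln_mult \<gamma>_def)
      finally have "\<beta> * ln m' \<le> \<beta> * (- (16 / \<eta>) + ln (real (card V)))" using \<beta> by (intro mult_left_mono) auto
      also have "\<dots> = - 1 + \<beta> * ln (real (card V))" using \<eta> by (simp add: \<beta>_def field_simps)
      finally have "q_max U E / m' \<ge> q_max V E / real (card V) + 1" using Uge by linarith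
      moreover have "q_max U E / m' \<le> 2" using q_max_le[OF grU U(2)] U(3) by (simp add: m'_def field_simps)
      ultimately show False using q0 k3 \<eta> by linarith
    qed
  qed
  then show thesis using that[of W] W by (simp add: F_def)
qed

theorem theorem2p11:
  fixes k :: nat
  assumes "k \<ge> 3"
  shows "\<exists>c::real. c > 0 \<and> (\<exists>n0::nat. \<forall>n \<ge> n0. \<forall>E.
           simple_graph n E \<and> q_index n E \<ge> q_index n (turan k) \<and> \<not> graph_iso n E (turan k)
           \<longrightarrow> (\<exists>t::nat. real t \<ge> c * real n \<and> contains_book n E k t))"
proof -
  \<comment> \<open>Chosen so that \<open>b = \<eta> * m\<close> meets the size hypothesis of
    \<open>k_partite_of_min_degree\<close> with equality.\<close>
  define \<eta> where "\<eta> = 1 / (3 * real k * (real k + 1) * (real k + 2))"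
  define \<gamma> where "\<gamma> = exp (- (16 / \<eta>))"
  have k: "k \<ge> 2" "real k \<ge> 3" using assms by auto
  have "3 * 3 * 3 * 3 \<le> 3 * real k * (real k + 1) * (real k + 2)"
    using k by (intro mult_mono) auto
  then have \<eta>: "0 < \<eta>" "\<eta> \<le> 1 / 12" unfolding \<eta>_def by (auto simp: divide_simps)
  have \<gamma>: "\<gamma> > 0" by (simp add: \<gamma>_def)
  \<comment> \<open>The three bounds secure nonempty Turan parts, room for the descent, and
    \<open>2 * k / n < \<eta> / 16\<close>, which rules out even one deletion.\<close>
  obtain n0 :: nat where n0: "real n0 \<ge> max (real k) (max ((1 + 64 / \<eta>) / \<gamma>) (32 * real k / \<eta> + 1))"
    using real_arch_simple by blast
  have "\<exists>t::nat. real t \<ge> (\<eta> * \<gamma>) * real n \<and> contains_book n E k t"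
    if n: "n \<ge> n0" and G: "simple_graph n E" and q: "q_index n E \<ge> q_index n (turan k)"
      and niso: "\<not> graph_iso n E (turan k)" for n E
  proof (rule ccontr)
    assume no: "\<not> ?thesis"
    have nr: "real n \<ge> real n0" using n by simp
    have nk: "n \<ge> k" using n0 nr by simp
    then have n_pos: "n > 0" "real n > 0" using k by auto
    have n_gamma: "\<gamma> * real n \<ge> 1 + 64 / \<eta>"
    proof -
      have "(1 + 64 / \<eta>) / \<gamma> \<le> real n" using n0 nr by linarith
      then show ?thesis using \<gamma> by (simp add: field_simps)
    qed
    have n_eta: "2 * real k / real n < \<eta> / 16"
    proof -
      have "32 * real k / \<eta> < real n" using n0 nr by linarith
      then show ?thesis using \<eta> n_pos by (simp add: field_simps)
    qed
    have gr: "graph_on {..<n} E" using G by (simp add: graph_on_simple_graph)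
    have q: "q_max {..<n} E \<ge> q_max {..<n} (turan k)"
      using q by (simp add: q_index_eq_q_max[OF _ n_pos(1)] G simple_graph_turan)
    have qT: "q_max {..<n} (turan k) \<ge> (2 - 2 / real k) * real n - 2 * real k / real n"
      using nk k by (intro q_max_turan_ge) auto
    have n1: "real n \<ge> 1" using n_pos by simp
    have "2 / real k \<le> 2 / 3" using k by (simp add: field_simps)
    then have "(4 / 3) * real n \<le> (2 - 2 / real k) * real n" by (intro mult_right_mono) auto
    then have qTn: "q_max {..<n} (turan k) > real n" using qT n_eta \<eta> n1 by linarith
    have "\<eta> * real n \<ge> \<eta> * 1" using \<eta> n1 by (intro mult_left_mono) auto
    then have q\<eta>: "q_max {..<n} E \<ge> (2 - 2 / real k - \<eta>) * real (card {..<n})"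
    proof -
      have "(2 - 2 / real k - \<eta>) * real n = (2 - 2 / real k) * real n - \<eta> * real n" by (simp add: left_diff_distrib)
      then show ?thesis using q qT n_eta \<eta> \<open>\<eta> * real n \<ge> \<eta> * 1\<close> unfolding card_lessThan by linarith
    qed
    have ne: "{..<n} \<noteq> {}" using n_pos by (simp add: lessThan_empty_iff)
    obtain W where W: "W \<subseteq> {..<n}" "W \<noteq> {}" "real (card W) \<ge> \<gamma> * real n"
      "q_max W E / real (card W) + \<eta> / 16 * ln (real (card W)) \<ge> q_max {..<n} E / real n + \<eta> / 16 * ln (real n)"
      "\<And>v. v \<in> W \<Longrightarrow> real (card (nbrs W E v)) > (1 - 1 / real k - \<eta>) * real (card W)"
      using q_max_descent[OF gr ne \<eta> assms q\<eta>] n_gamma unfolding \<gamma>_def by auto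
    define m where "m = real (card W)"
    have grW: "graph_on W E" using gr W(1) by (rule graph_on_subset)
    have finW: "finite W" using W(1) finite_subset by blast
    have m: "m > 0" using W(2) finW by (simp add: m_def card_gt_0_iff)
    have "\<exists>p. (\<forall>u\<in>W. p u < k) \<and> (\<forall>u\<in>W. \<forall>w\<in>W. E u w \<longrightarrow> p u \<noteq> p w)"
    proof (rule k_partite_of_min_degree[OF grW k(1), where b = "\<eta> * m"])
      show "\<eta> * m > 0" using \<eta> m by simp
      show "3 * (real k + 1) * (real k + 2) * (\<eta> * m) \<le> real (card W) / real k"
      proof -
        define D where "D = 3 * (real k + 1) * (real k + 2)"
        have "D > 0" using k by (simp add: D_def)
        moreover have "\<eta> = 1 / (real k * D)" by (simp add: \<eta>_def D_def ac_simps)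
        ultimately have "D * (\<eta> * m) = m / real k" by simp
        then show ?thesis by (simp add: D_def m_def)
      qed
      show "real (card {w\<in>W. \<not> E u w}) \<le> real (card W) / real k + \<eta> * m" if u: "u \<in> W" for u
      proof -
        have "{w\<in>W. \<not> E u w} = W - nbrs W E u" by (auto simp: nbrs_def)
        then have "real (card {w\<in>W. \<not> E u w}) = m - real (card (nbrs W E u))"
          using finW nbrs_subset[of W E u] card_mono[OF finW nbrs_subset, of E u]
          by (simp add: m_def card_Diff_subset finite_subset of_nat_diff)
        then show ?thesis using W(5)[OF u] by (simp add: m_def algebra_simps)
      qed
      fix S assume S: "clique_on W E S" "card S = k"
      \<comment> \<open>Pages are collected in the whole graph. As
        \<open>card W \<ge> \<gamma> * n\<close>, fewer than \<open>\<eta> * \<gamma> * n\<close> of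
        them is fewer than \<open>\<eta> * m\<close>.\<close>
      define T where "T = {w\<in>{..<n}. \<forall>u\<in>S. E u w}"
      have SW: "S \<subseteq> {..<n}" using S W(1) by (auto simp: clique_on_def)
      have "S \<inter> T = {}" using SW G by (auto simp: T_def simple_graph_def)
      then have "contains_book n E k (card T)"
        unfolding contains_book_def using S SW
        by (intro exI[of _ S] exI[of _ T]) (auto simp: T_def clique_on_def)
      then have "real (card T) < (\<eta> * \<gamma>) * real n" using no by (meson not_less)
      also have "\<dots> \<le> \<eta> * m" using W(3) \<eta> by (simp add: m_def)
      finally have "real (card T) < \<eta> * m" .
      moreover have "card {w\<in>W. \<forall>u\<in>S. E u w} \<le> card T"
        using W(1) by (intro card_mono) (auto simp: T_def)
      ultimately show "real (card {w\<in>W. \<forall>u\<in>S. E u w}) < \<eta> * m" by linarith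
    qed
    then obtain p where p: "\<And>u. u \<in> W \<Longrightarrow> p u < k" "\<And>u w. u \<in> W \<Longrightarrow> w \<in> W \<Longrightarrow> E u w \<Longrightarrow> p u \<noteq> p w"
      by blast
    have "q_max W E / m \<le> 2 - 2 / real k"
      using k_partite_q_max_le[OF grW W(2) k(1) p] m by (simp add: m_def field_simps)
    moreover have "q_max {..<n} E / real n \<ge> 2 - 2 / real k - (2 * real k / real n) / real n"
    proof -
      have "((2 - 2 / real k) * real n - 2 * real k / real n) / real n \<le> q_max {..<n} E / real n"
        using q qT by (intro divide_right_mono) auto
      then show ?thesis using n_pos by (simp add: diff_divide_distrib)
    qed
    \<comment> \<open>The ratio starts at most \<open>2 * k / n\<^sup>2\<close> below
      \<open>2 - 2 / k\<close> and ends at most at this value, so hardly any growth is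
      possible.\<close>
    ultimately have "\<eta> / 16 * (ln (real n) - ln m) \<le> (2 * real k / real n) / real n"
      using W(4) unfolding m_def[symmetric] right_diff_distrib by linarith
    also have "\<dots> < (\<eta> / 16) / real n" using n_eta n_pos by (intro divide_strict_right_mono) auto
    finally have "\<eta> / 16 * (ln (real n) - ln m) < \<eta> / 16 * (1 / real n)" by simp
    then have "ln (real n) - ln m < 1 / real n"
      by (rule mult_less_cancel_left_pos[THEN iffD1, rotated]) (use \<eta> in simp)
    \<comment> \<open>A single deleted vertex would already make the left side at least
      \<open>1 / n\<close>; hence \<open>m > n - 1\<close>, and integrality gives
      \<open>W = {..<n}\<close>.\<close>
    moreover have "ln (real n) - ln m \<ge> 1 - m / real n"
      using ln_le_minus_one[of "m / real n"] m n_pos by (simp add: ln_div)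
    ultimately have "m > real n - 1" using n_pos by (simp add: field_simps)
    then have "card W \<ge> card {..<n}" by (simp add: m_def)
    then have "W = {..<n}" using W(1) card_mono[OF _ W(1)] by (intro card_subset_eq) auto
    then have "graph_iso n E (turan k)"
      using p by (intro turan_extremal_k_partite[OF k(1) nk G _ _ qTn q, of p]) auto
    then show False using niso by contradiction
  qed
  then show ?thesis using \<eta> \<gamma> by (intro exI[of _ "\<eta> * \<gamma>"] conjI exI[of _ n0]) auto
qed

end
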